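(* Let $M$ be a simply connected domain in $\mathbb{C}$ with coordinate $z$ and metric $ds_M^2$ conformal to $dz\,d\bar z$, and let $\varphi:M\to\mathbb{H}P^n$ be a linearly full totally real isometric minimal immersion. Then there exists a totally real isometric horizontal minimal lift $[s]:M\to\mathbb{C}P^{2n+1}$ of $\varphi$; that is, there is a smooth $s:M\to S^{4n+3}\subset\mathbb{C}^{2n+2}$ with $\pi\circ s=\varphi$ and $\langle ds,s\rangle=\langle ds,\mathrm{j}s\rangle=0$ such that $[s]:M\to\mathbb{C}P^{2n+1}$ is a totally real isometric minimal immersion.
   Context: Identify $\mathbb{C}^{2n+2}$ with $\mathbb{H}^{n+1}$ by $(z_1,z_2,\dots,z_{2n+1},z_{2n+2})\leftrightarrow(z_1+z_2\mathrm{j},\dots,z_{2n+1}+z_{2n+2}\mathrm{j})$, with the standard Hermitian product $\langle z,w\rangle=\sum_k z_k\bar w_k$ and real inner product $\mathrm{Re}\langle\cdot,\cdot\rangle$. Left multiplication by $\mathrm{j}$ is the conjugate-linear map $\mathrm{j}v=J_{n+1}\bar v$, where $J_{n+1}$ is block diagonal with $n+1$ blocks $\begin{pmatrix}0&-1\\1&0\end{pmatrix}$. $\mathbb{H}P^n$ is the space of one-dimensional quaternionic subspaces of $\mathbb{H}^{n+1}$ for left scalar multiplication. Write $\pi:S^{4n+3}\to\mathbb{H}P^n$, $\pi(q)=[z_1+z_2\mathrm{j},\dots,z_{2n+1}+z_{2n+2}\mathrm{j}]$; its horizontal space at $q$ is $\mathcal H_q=\{v:\langle v,q\rangle=\langle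 v,\mathrm{j}q\rangle=0\}$, and $\mathbb{H}P^n$ has the metric making $\pi$ a Riemannian submersion from the unit sphere. The local quaternionic Kähler structure $\{I,J,K\}$ is induced on $\mathcal H_q\cong T_{\pi(q)}\mathbb{H}P^n$ by left multiplication by $\mathrm{i},\mathrm{j},\mathrm{k}$. $\mathbb{C}P^{2n+1}$ carries the Fubini–Study metric of constant holomorphic sectional curvature $4$ (so that $S^{4n+3}\to\mathbb{C}P^{2n+1}$ is a Riemannian submersion). It is the twistor space of $\mathbb{H}P^n$, with twistor map $t([z_1,\dots,z_{2n+2}])=[z_1+z_2\mathrm{j},\dots,z_{2n+1}+z_{2n+2}\mathrm{j}]$; $[s]$ is a lift of $\varphi$ means $t\circ[s]=\varphi$. An isometric immersion of a surface into $\mathbb{H}P^n$ is totally real if the two-forms $\omega_I(X,Y)=g(IX,Y)$, $\omega_J(X,Y)=g(JX,Y)$, $\omega_K(X,Y)=g(KX,Y)$ all pull back to zero at each point. An isometric immersion into $\mathbb{C}P^{2n+1}$ is totally real if the Kähler form pulls back to zero (Kähler angle $\pi/2$). $\varphi$ is linearly full if its image is contained in no proper quaternionic projective subspace $\mathbb{H}P^m\subset\mathbb{H}P^n$, $m<n$. *)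

theory Defs
  imports "HOL-Analysis.Analysis"
begin

section \<open>Quaternionic structure on complex coordinates\<close>

text \<open>
  \<open>\<complex>\<^sup>2\<^sup>n\<^sup>+\<^sup>2\<close> is \<open>complex ^ ('m \<times> 2)\<close> with \<open>n + 1 = CARD('m)\<close>: the \<open>k\<close>-th quaternionic
  coordinate of \<open>z\<close> is \<open>z $ (k, 1) + z $ (k, 2) j\<close>. Complex scalars act by \<open>*s\<close>.
  The library inner product \<open>\<bullet>\<close> on this type is the real part of \<open>herm\<close>.
\<close>

definition herm :: "complex ^ ('k::finite) \<Rightarrow> complex ^ 'k \<Rightarrow> complex" where
  "herm z w = (\<Sum>k\<in>UNIV. z $ k * cnj (w $ k))"

definition jmul :: "complex ^ ('m::finite \<times> 2) \<Rightarrow> complex ^ ('m \<times> 2)" where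
  "jmul v = (\<chi> p. if snd p = 1 then - cnj (v $ (fst p, 2)) else cnj (v $ (fst p, 1)))"

definition kmul :: "complex ^ ('m::finite \<times> 2) \<Rightarrow> complex ^ ('m \<times> 2)" where
  "kmul v = \<i> *s jmul v"

definition cline :: "complex ^ ('m::finite \<times> 2) \<Rightarrow> (complex ^ ('m \<times> 2)) set" where
  "cline v = {a *s v |a. True}"

text \<open>The left multiples \<open>(a + b j) v\<close> of \<open>v\<close> by quaternions.\<close>

definition hline :: "complex ^ ('m::finite \<times> 2) \<Rightarrow> (complex ^ ('m \<times> 2)) set" where
  "hline v = {a *s v + b *s jmul v |a b. True}"

definition cp_hor :: "complex ^ ('m::finite \<times> 2) \<Rightarrow> (complex ^ ('m \<times> 2)) set" where
  "cp_hor q = {v. herm v q = 0}"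

definition hp_hor :: "complex ^ ('m::finite \<times> 2) \<Rightarrow> (complex ^ ('m \<times> 2)) set" where
  "hp_hor q = {v. herm v q = 0 \<and> herm v (jmul q) = 0}"

text \<open>
  \<open>t([z]) = [z\<^sub>1 + z\<^sub>2 j, \<dots>]\<close>: the twistor map sends a complex line to the quaternionic line
  \<open>l + j l\<close> spanned by it.
\<close>

definition twistor :: "(complex ^ ('m::finite \<times> 2)) set \<Rightarrow> (complex ^ ('m \<times> 2)) set" where
  "twistor l = {x + jmul y |x y. x \<in> l \<and> y \<in> l}"


section \<open>Smoothness and the Levi-Civita connection in a linear chart\<close>

text \<open>Real differentiability classes; \<open>S\<close> is meant to be open.\<close>

fun Ck_on :: "nat \<Rightarrow> 'a::real_normed_vector set \<Rightarrow> ('a \<Rightarrow> 'b::real_normed_vector) \<Rightarrow> bool" where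
  "Ck_on 0 S f \<longleftrightarrow> continuous_on S f"
| "Ck_on (Suc k) S f \<longleftrightarrow> (\<forall>x\<in>S. f differentiable (at x)) \<and>
     (\<forall>v. Ck_on k S (\<lambda>x. frechet_derivative f (at x) v))"

definition smooth_on :: "'a::real_normed_vector set \<Rightarrow> ('a \<Rightarrow> 'b::real_normed_vector) \<Rightarrow> bool" where
  "smooth_on S f \<longleftrightarrow> (\<forall>k. Ck_on k S f)"

definition dir_deriv :: "('a::real_vector \<Rightarrow> real) \<Rightarrow> 'a \<Rightarrow> 'a \<Rightarrow> real" where
  "dir_deriv F w u = deriv (\<lambda>t::real. F (w + t *\<^sub>R u)) 0"

text \<open>
  For a Riemannian metric \<open>G\<close> on (an open part of) a linear space \<open>V\<close>, \<open>christoffel V G w u v\<close>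
  is the value at \<open>w\<close> of the Levi-Civita derivative of the constant field \<open>v\<close> along the
  constant field \<open>u\<close>. It is determined by Koszul's formula, in which the bracket terms vanish
  for constant fields.
\<close>

definition christoffel ::
  "'a::real_inner set \<Rightarrow> ('a \<Rightarrow> 'a \<Rightarrow> 'a \<Rightarrow> real) \<Rightarrow> 'a \<Rightarrow> 'a \<Rightarrow> 'a \<Rightarrow> 'a" where
  "christoffel V G w u v =
     (THE c. c \<in> V \<and> (\<forall>x\<in>V. 2 * G w c x =
        dir_deriv (\<lambda>y. G y v x) w u + dir_deriv (\<lambda>y. G y u x) w v - dir_deriv (\<lambda>y. G y u v) w x))"


section \<open>Projective spaces as quotients of the unit sphere\<close>

text \<open>
  Both projective spaces are given by a projection \<open>L\<close> from the unit sphere (\<open>cline\<close> or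
  \<open>hline\<close>, a point of the space being a line in \<open>\<complex>\<^sup>2\<^sup>n\<^sup>+\<^sup>2\<close>) and its horizontal spaces \<open>H q\<close>
  (\<open>cp_hor\<close> or \<open>hp_hor\<close>). For each unit vector \<open>q\<close> there is an affine chart with values in the
  linear space \<open>H q\<close>: the vector \<open>w\<close> is the coordinate of the line through \<open>q + w\<close>, and the
  chart covers the lines that are not orthogonal to \<open>q\<close>. The point \<open>L q\<close> has coordinate \<open>0\<close>,
  and there the coordinate vector \<open>u \<in> H q\<close> represents the tangent vector \<open>dL\<^sub>q(u)\<close>; this is
  the usual identification of \<open>H q\<close> with the tangent space at \<open>L q\<close>.
\<close>

definition chart_dom :: "('e::real_normed_vector \<Rightarrow> 'e set) \<Rightarrow> ('e \<Rightarrow> 'e set) \<Rightarrow> 'e \<Rightarrow> 'e set set" where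
  "chart_dom L H q = (\<lambda>w. L (q + w)) ` H q"

definition coord :: "('e::real_normed_vector \<Rightarrow> 'e set) \<Rightarrow> ('e \<Rightarrow> 'e set) \<Rightarrow> 'e \<Rightarrow> 'e set \<Rightarrow> 'e" where
  "coord L H q = inv_into (H q) (\<lambda>w. L (q + w))"

text \<open>
  The metric making \<open>L\<close> a Riemannian submersion, in the chart of \<open>q\<close>. The map
  \<open>\<sigma> w = sgn (q + w)\<close> is a local section over the chart, so a coordinate vector \<open>u\<close> at \<open>w\<close>
  represents \<open>dL(d\<sigma>\<^sub>w(u))\<close>, whose horizontal lift at \<open>\<sigma> w\<close> is the orthogonal projection of
  \<open>d\<sigma>\<^sub>w(u)\<close> to the linear subspace \<open>H (\<sigma> w)\<close>, i.e. its closest point there.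
\<close>

definition hor_lift :: "('e::euclidean_space \<Rightarrow> 'e set) \<Rightarrow> 'e \<Rightarrow> 'e \<Rightarrow> 'e \<Rightarrow> 'e" where
  "hor_lift H q w u =
     closest_point (H (sgn (q + w))) (frechet_derivative (\<lambda>y. sgn (q + y)) (at w) u)"

definition quot_metric :: "('e::euclidean_space \<Rightarrow> 'e set) \<Rightarrow> 'e \<Rightarrow> 'e \<Rightarrow> 'e \<Rightarrow> 'e \<Rightarrow> real" where
  "quot_metric H q w u v = hor_lift H q w u \<bullet> hor_lift H q w v"


section \<open>Surfaces in projective spaces\<close>

text \<open>The metrics on \<open>M\<close> conformal to the Euclidean metric \<open>|dz|\<^sup>2\<close>; \<open>u \<bullet> v\<close> is the real part of \<open>u * cnj v\<close>.\<close>

definition conformal_metric_on :: "complex set \<Rightarrow> (complex \<Rightarrow> complex \<Rightarrow> complex \<Rightarrow> real) \<Rightarrow> bool" where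
  "conformal_metric_on M g \<longleftrightarrow>
     (\<exists>lam. smooth_on M lam \<and> (\<forall>z\<in>M. lam z > 0 \<and> (\<forall>u v. g z u v = lam z * (u \<bullet> v))))"

text \<open>
  Local properties of \<open>f\<close> at \<open>p\<close> are stated in the charts centred at \<open>f p\<close>, one for each unit
  vector \<open>q\<close> in the fibre over \<open>f p\<close>.
\<close>

definition smooth_map ::
  "('e::euclidean_space \<Rightarrow> 'e set) \<Rightarrow> ('e \<Rightarrow> 'e set) \<Rightarrow> complex set \<Rightarrow> (complex \<Rightarrow> 'e set) \<Rightarrow> bool" where
  "smooth_map L H M f \<longleftrightarrow>
     f ` M \<subseteq> L ` sphere 0 1 \<and>
     (\<forall>p\<in>M. \<forall>q\<in>sphere 0 1. L q = f p \<longrightarrow>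
        (\<exists>U. open U \<and> p \<in> U \<and> U \<subseteq> M \<and> f ` U \<subseteq> chart_dom L H q \<and>
             smooth_on U (\<lambda>x. coord L H q (f x))))"

definition diff_map ::
  "('e::euclidean_space \<Rightarrow> 'e set) \<Rightarrow> ('e \<Rightarrow> 'e set) \<Rightarrow> 'e \<Rightarrow> (complex \<Rightarrow> 'e set) \<Rightarrow>
   complex \<Rightarrow> complex \<Rightarrow> 'e" where
  "diff_map L H q f p X = frechet_derivative (\<lambda>x. coord L H q (f x)) (at p) X"

definition isometric_immersion ::
  "('e::euclidean_space \<Rightarrow> 'e set) \<Rightarrow> ('e \<Rightarrow> 'e set) \<Rightarrow> complex set \<Rightarrow>
   (complex \<Rightarrow> complex \<Rightarrow> complex \<Rightarrow> real) \<Rightarrow> (complex \<Rightarrow> 'e set) \<Rightarrow> bool" where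
  "isometric_immersion L H M g f \<longleftrightarrow>
     smooth_map L H M f \<and>
     (\<forall>p\<in>M. \<forall>q\<in>sphere 0 1. L q = f p \<longrightarrow>
        (\<forall>X Y. quot_metric H q (coord L H q (f p)) (diff_map L H q f p X) (diff_map L H q f p Y)
               = g p X Y))"

text \<open>
  The second fundamental form \<open>\<nabla>df(X, Y) = \<nabla>\<^sub>X(df Y) - df(\<nabla>\<^sub>X Y)\<close>, formed with the Levi-Civita
  connections of \<open>g\<close> and of the target.
\<close>

definition second_ff ::
  "('e::euclidean_space \<Rightarrow> 'e set) \<Rightarrow> ('e \<Rightarrow> 'e set) \<Rightarrow> (complex \<Rightarrow> complex \<Rightarrow> complex \<Rightarrow> real) \<Rightarrow>
   'e \<Rightarrow> (complex \<Rightarrow> 'e set) \<Rightarrow> complex \<Rightarrow> complex \<Rightarrow> complex \<Rightarrow> 'e" where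
  "second_ff L H g q f p X Y =
     frechet_derivative (\<lambda>x. diff_map L H q f x Y) (at p) X
     + christoffel (H q) (quot_metric H q) (coord L H q (f p))
         (diff_map L H q f p X) (diff_map L H q f p Y)
     - diff_map L H q f p (christoffel UNIV g p X Y)"

text \<open>Vanishing mean curvature: the trace of \<open>second_ff\<close> in \<open>g\<close>-orthonormal frames is zero.\<close>

definition minimal ::
  "('e::euclidean_space \<Rightarrow> 'e set) \<Rightarrow> ('e \<Rightarrow> 'e set) \<Rightarrow> complex set \<Rightarrow>
   (complex \<Rightarrow> complex \<Rightarrow> complex \<Rightarrow> real) \<Rightarrow> (complex \<Rightarrow> 'e set) \<Rightarrow> bool" where
  "minimal L H M g f \<longleftrightarrow>
     (\<forall>p\<in>M. \<forall>q\<in>sphere 0 1. L q = f p \<longrightarrow>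
        (\<forall>e1 e2. g p e1 e1 = 1 \<and> g p e2 e2 = 1 \<and> g p e1 e2 = 0 \<longrightarrow>
           second_ff L H g q f p e1 e1 + second_ff L H g q f p e2 e2 = 0))"

text \<open>
  The endomorphisms \<open>I\<close>, \<open>J\<close>, \<open>K\<close> at \<open>f p\<close> are left multiplication by \<open>i\<close>, \<open>j\<close>, \<open>k\<close> on \<open>H q\<close>.
\<close>

definition form_pullback_zero ::
  "('e::euclidean_space \<Rightarrow> 'e set) \<Rightarrow> ('e \<Rightarrow> 'e set) \<Rightarrow> ('e \<Rightarrow> 'e) \<Rightarrow> complex set \<Rightarrow>
   (complex \<Rightarrow> 'e set) \<Rightarrow> bool" where
  "form_pullback_zero L H A M f \<longleftrightarrow>
     (\<forall>p\<in>M. \<forall>q\<in>sphere 0 1. L q = f p \<longrightarrow>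
        (\<forall>X Y. quot_metric H q (coord L H q (f p))
                 (A (diff_map L H q f p X)) (diff_map L H q f p Y) = 0))"

definition cp_totally_real :: "complex set \<Rightarrow> (complex \<Rightarrow> (complex ^ ('m::finite \<times> 2)) set) \<Rightarrow> bool" where
  "cp_totally_real M f \<longleftrightarrow> form_pullback_zero cline cp_hor (\<lambda>v. \<i> *s v) M f"

definition hp_totally_real :: "complex set \<Rightarrow> (complex \<Rightarrow> (complex ^ ('m::finite \<times> 2)) set) \<Rightarrow> bool" where
  "hp_totally_real M f \<longleftrightarrow>
     form_pullback_zero hline hp_hor (\<lambda>v. \<i> *s v) M f \<and>
     form_pullback_zero hline hp_hor jmul M f \<and>
     form_pullback_zero hline hp_hor kmul M f"

definition quat_subspace :: "(complex ^ ('m::finite \<times> 2)) set \<Rightarrow> bool" where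
  "quat_subspace V \<longleftrightarrow> vec.subspace V \<and> (\<forall>v\<in>V. jmul v \<in> V)"

text \<open>The projective subspace of a quaternionic subspace \<open>V\<close> is the set of quaternionic lines in \<open>V\<close>.\<close>

definition linearly_full :: "complex set \<Rightarrow> (complex \<Rightarrow> (complex ^ ('m::finite \<times> 2)) set) \<Rightarrow> bool" where
  "linearly_full M f \<longleftrightarrow>
     \<not> (\<exists>V. quat_subspace V \<and> V \<noteq> {0} \<and> V \<noteq> UNIV \<and> f ` M \<subseteq> {l \<in> hline ` sphere 0 1. l \<subseteq> V})"

end

theory Submission
  imports Defs "HOL-Complex_Analysis.Riemann_Mapping"
begin

text \<open>
  Let \<open>P x\<close> be the orthogonal projection of \<open>\<complex>\<^sup>2\<^sup>n\<^sup>+\<^sup>2\<close> onto the quaternionic line \<open>\<phi> x\<close>. A map \<open>s\<close>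
  with \<open>P s = s\<close> is horizontal exactly when \<open>ds = dP s\<close>, which is parallel transport for the
  connection that the submersion \<open>S\<^sup>4\<^sup>n\<^sup>+\<^sup>3 \<rightarrow> \<H>P\<^sup>n\<close> induces on the tautological bundle over \<open>M\<close>. Its
  curvature, \<open>[dP X, dP Y]\<close> on the image of \<open>P\<close>, consists of the pullbacks of \<open>\<omega>\<^sub>I, \<omega>\<^sub>J, \<omega>\<^sub>K\<close>, so
  it vanishes when \<open>\<phi>\<close> is totally real. Since \<open>M\<close> is simply connected, the Riemann mapping theorem
  reduces the integration of \<open>ds = dP s\<close> to a convex domain, where it is done along rays.

  For a horizontal lift, the charts of \<open>\<complex>P\<^sup>2\<^sup>n\<^sup>+\<^sup>1\<close> and \<open>\<H>P\<^sup>n\<close> centred at \<open>s p\<close> represent \<open>[s]\<close> and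
  \<open>\<phi>\<close> by functions with the same 2-jet at \<open>p\<close>, and both metrics are Euclidean to first order at
  the centre. Hence \<open>[s]\<close> and \<open>\<phi>\<close> have the same differential and second fundamental form.
\<close>

section \<open>Calculus of smooth maps\<close>

text \<open>Differentiating \<open>P s = s\<close> gives \<open>ds = dP s + P ds\<close>, and
  horizontality says \<open>P ds = 0\<close>; this is the origin of \<open>ds = dP s\<close>. Stated
  through \<open>P\<close> rather than through local unit sections, the equation is linear, its
  coefficient is defined on all of \<open>M\<close>, and its unknown lives in one fixed vector
  space, so neither gauge changes nor gluing occur. Since \<open>P\<close> is idempotent and
  self-adjoint, solutions stay in the image of \<open>P\<close> and keep their norm, which keeps
  \<open>s\<close> on the sphere and over \<open>\<phi>\<close>.

  Total reality enters a second time when second derivatives are compared. The direction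
  \<open>jmul s\<close> is tangent to complex projective space but vertical over quaternionic
  projective space, and the second derivative of \<open>s\<close> has in this direction the
  component \<open>herm (ds Y) (jmul (ds X))\<close> up to sign. Its vanishing is what carries
  minimality up to the lift.\<close>

lemma frechet_cong_open:
  assumes "open S" "x \<in> S" "\<And>y. y \<in> S \<Longrightarrow> f y = g y"
  shows "f differentiable (at x) \<longleftrightarrow> g differentiable (at x)"
    and "frechet_derivative f (at x) = frechet_derivative g (at x)"
proof -
  have *: "(f has_derivative D) (at x) \<longleftrightarrow> (g has_derivative D) (at x)" for D
    using assms by (metis has_derivative_transform_within_open)
  show "f differentiable (at x) \<longleftrightarrow> g differentiable (at x)"
    by (simp add: differentiable_def *)
  show "frechet_derivative f (at x) = frechet_derivative g (at x)"
    by (simp add: frechet_derivative_def *)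
qed

lemma Ck_on_cong:
  assumes "open S" "\<And>y. y \<in> S \<Longrightarrow> f y = g y"
  shows "Ck_on k S f \<longleftrightarrow> Ck_on k S g"
  using assms(2)
proof (induction k arbitrary: f g)
  case 0
  then show ?case by (simp cong: continuous_on_cong)
next
  case (Suc k)
  have "Ck_on k S (\<lambda>x. frechet_derivative f (at x) v) \<longleftrightarrow> Ck_on k S (\<lambda>x. frechet_derivative g (at x) v)" for v
    by (rule Suc.IH) (use frechet_cong_open(2)[OF assms(1) _ Suc.prems] in simp)
  then show ?case
    using frechet_cong_open(1)[OF assms(1) _ Suc.prems] by simp
qed

lemma Ck_on_subset: "Ck_on k S f \<Longrightarrow> T \<subseteq> S \<Longrightarrow> Ck_on k T f"
  by (induction k arbitrary: f) (auto intro: continuous_on_subset)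

lemma Ck_on_locally:
  assumes "\<And>x. x \<in> S \<Longrightarrow> \<exists>U. open U \<and> x \<in> U \<and> Ck_on k U f"
  shows "Ck_on k S f"
  using assms
proof (induction k arbitrary: f)
  case 0
  have "isCont f x" if "x \<in> S" for x
    using 0[OF that] by (auto simp: continuous_on_eq_continuous_at)
  then show ?case by (simp add: continuous_at_imp_continuous_on)
next
  case (Suc k)
  have "Ck_on k S (\<lambda>x. frechet_derivative f (at x) v)" for v
    by (rule Suc.IH) (use Suc.prems in force)
  then show ?case using Suc.prems by fastforce
qed

lemma Ck_on_Suc_imp: "Ck_on (Suc k) S f \<Longrightarrow> Ck_on k S f"
proof (induction k arbitrary: f)
  case 0
  then show ?case
    by (auto intro!: continuous_at_imp_continuous_on differentiable_imp_continuous_within)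
next
  case (Suc k)
  have "Ck_on k S (\<lambda>x. frechet_derivative f (at x) v)" for v
    by (rule Suc.IH) (use Suc.prems in simp)
  with Suc.prems show ?case by simp
qed

text \<open>\<open>frechet_derivative\<close> is a choice operator; uniqueness of derivatives on an
  open set lets any explicit formula \<open>D\<close> replace it. The closure rules below rest on
  this.\<close>

lemma Ck_on_SucI:
  assumes "open S" "\<And>x. x \<in> S \<Longrightarrow> (f has_derivative D x) (at x)"
    and "\<And>v. Ck_on k S (\<lambda>x. D x v)"
  shows "Ck_on (Suc k) S f"
proof -
  have eq: "frechet_derivative f (at x) = D x" if "x \<in> S" for x
    using assms(2)[OF that] frechet_derivative_at by metis
  have "Ck_on k S (\<lambda>x. frechet_derivative f (at x) v)" for v
    by (subst Ck_on_cong[OF assms(1), of _ "\<lambda>x. D x v"]) (simp_all add: eq assms(3))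
  then show ?thesis using assms(2) by (auto simp: differentiable_def)
qed

lemma Ck_on_SucD:
  assumes "Ck_on (Suc k) S f" "x \<in> S"
  shows "(f has_derivative frechet_derivative f (at x)) (at x)"
  using assms by (simp add: frechet_derivative_works)

lemma Ck_on_const: "open S \<Longrightarrow> Ck_on k S (\<lambda>x. c)"
proof (induction k arbitrary: c)
  case (Suc k)
  show ?case by (rule Ck_on_SucI[where D="\<lambda>x v. 0"]) (auto simp: Suc)
qed simp

lemma Ck_on_add:
  assumes "open S" "Ck_on k S f" "Ck_on k S g"
  shows "Ck_on k S (\<lambda>x. f x + g x)"
  using assms(2,3)
proof (induction k arbitrary: f g)
  case 0
  then show ?case by (auto intro: continuous_intros)
next
  case (Suc k)
  show ?case
    by (rule Ck_on_SucI[OF assms(1) has_derivative_add[OF Ck_on_SucD[OF Suc.prems(1)] Ck_on_SucD[OF Suc.prems(2)]]])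
      (use Suc in auto)
qed

lemma Ck_on_bounded_linear:
  assumes "open S" "bounded_linear h" "Ck_on k S f"
  shows "Ck_on k S (\<lambda>x. h (f x))"
  using assms(3)
proof (induction k arbitrary: f)
  case 0
  then show ?case by (auto intro: bounded_linear.continuous_on[OF assms(2)])
next
  case (Suc k)
  show ?case
    by (rule Ck_on_SucI[OF assms(1) bounded_linear.has_derivative[OF assms(2) Ck_on_SucD[OF Suc.prems]]])
      (use Suc in auto)
qed

lemma Ck_on_bilinear:
  assumes "open S" "bounded_bilinear b" "Ck_on k S f" "Ck_on k S g"
  shows "Ck_on k S (\<lambda>x. b (f x) (g x))"
  using assms(3,4)
proof (induction k arbitrary: f g)
  case 0
  then show ?case by (auto intro: bounded_bilinear.continuous_on[OF assms(2)])
next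
  case (Suc k)
  note f = Suc.prems(1) and g = Suc.prems(2)
  show ?case
    by (rule Ck_on_SucI[OF assms(1) bounded_bilinear.FDERIV[OF assms(2) Ck_on_SucD[OF f] Ck_on_SucD[OF g]]])
      (use f g Ck_on_Suc_imp[OF f] Ck_on_Suc_imp[OF g] in \<open>auto intro!: Ck_on_add[OF assms(1)] Suc.IH\<close>)
qed

text \<open>The derivative of the inverse contains the inverse itself, so the induction keeps
  \<open>f\<close> fixed and reuses its own hypothesis one order lower.\<close>

lemma Ck_on_inverse:
  fixes f :: "'a::real_normed_vector \<Rightarrow> 'b::real_normed_field"
  assumes "open S" "Ck_on k S f" "\<And>x. x \<in> S \<Longrightarrow> f x \<noteq> 0"
  shows "Ck_on k S (\<lambda>x. inverse (f x))"
  using assms(2)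
proof (induction k)
  case 0
  then show ?case using assms(3) by (auto intro: continuous_intros)
next
  case (Suc k)
  have inv: "Ck_on k S (\<lambda>x. inverse (f x))" using Suc Ck_on_Suc_imp by blast
  have "Ck_on k S (\<lambda>x. - (inverse (f x) * frechet_derivative f (at x) v * inverse (f x)))" for v
    using Suc.prems inv
    by (auto intro!: Ck_on_bounded_linear[OF assms(1) bounded_linear_minus[OF bounded_linear_ident]]
        Ck_on_bilinear[OF assms(1) bounded_bilinear_mult])
  then show ?case
    by (intro Ck_on_SucI[OF assms(1) Deriv.has_derivative_inverse[OF assms(3) Ck_on_SucD[OF Suc.prems]]])
qed

lemma Ck_on_sum:
  assumes "open S" "\<And>i. i \<in> I \<Longrightarrow> Ck_on k S (f i)"
  shows "Ck_on k S (\<lambda>x. \<Sum>i\<in>I. f i x)"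
  using assms(2) by (induction I rule: infinite_finite_induct)
    (auto intro!: Ck_on_const[OF assms(1)] Ck_on_add[OF assms(1)])

lemma smooth_on_SucD:
  assumes "smooth_on S f" "x \<in> S"
  shows "(f has_derivative frechet_derivative f (at x)) (at x)"
  using assms Ck_on_SucD[of 0] unfolding smooth_on_def by blast

lemma smooth_on_deriv:
  assumes "smooth_on S f"
  shows "smooth_on S (\<lambda>x. frechet_derivative f (at x) v)"
  using assms unfolding smooth_on_def by (metis Ck_on.simps(2))

lemma smooth_on_continuous: "smooth_on S f \<Longrightarrow> continuous_on S f"
  unfolding smooth_on_def using Ck_on.simps(1) by blast

lemma smooth_on_cong:
  assumes "open S" "\<And>y. y \<in> S \<Longrightarrow> f y = g y"
  shows "smooth_on S f \<longleftrightarrow> smooth_on S g"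
  using Ck_on_cong[OF assms] by (simp add: smooth_on_def)

lemma smooth_on_subset: "smooth_on S f \<Longrightarrow> T \<subseteq> S \<Longrightarrow> smooth_on T f"
  unfolding smooth_on_def using Ck_on_subset by blast

lemma smooth_on_locally:
  assumes "\<And>x. x \<in> S \<Longrightarrow> \<exists>U. open U \<and> x \<in> U \<and> smooth_on U f"
  shows "smooth_on S f"
  using assms unfolding smooth_on_def by (auto intro!: Ck_on_locally)

lemma smooth_on_const: "open S \<Longrightarrow> smooth_on S (\<lambda>x. c)"
  by (simp add: smooth_on_def Ck_on_const)

lemma smooth_on_add: "open S \<Longrightarrow> smooth_on S f \<Longrightarrow> smooth_on S g \<Longrightarrow> smooth_on S (\<lambda>x. f x + g x)"
  by (simp add: smooth_on_def Ck_on_add)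

lemma smooth_on_bounded_linear:
  "open S \<Longrightarrow> bounded_linear h \<Longrightarrow> smooth_on S f \<Longrightarrow> smooth_on S (\<lambda>x. h (f x))"
  by (simp add: smooth_on_def Ck_on_bounded_linear)

lemma smooth_on_bilinear:
  "open S \<Longrightarrow> bounded_bilinear b \<Longrightarrow> smooth_on S f \<Longrightarrow> smooth_on S g \<Longrightarrow> smooth_on S (\<lambda>x. b (f x) (g x))"
  by (simp add: smooth_on_def Ck_on_bilinear)

lemma smooth_on_inverse:
  fixes f :: "'a::real_normed_vector \<Rightarrow> 'b::real_normed_field"
  shows "open S \<Longrightarrow> smooth_on S f \<Longrightarrow> (\<And>x. x \<in> S \<Longrightarrow> f x \<noteq> 0) \<Longrightarrow> smooth_on S (\<lambda>x. inverse (f x))"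
  by (simp add: smooth_on_def Ck_on_inverse)

lemma smooth_on_sum:
  "open S \<Longrightarrow> (\<And>i. i \<in> I \<Longrightarrow> smooth_on S (f i)) \<Longrightarrow> smooth_on S (\<lambda>x. \<Sum>i\<in>I. f i x)"
  by (simp add: smooth_on_def Ck_on_sum)

lemma smooth_on_diff: "open S \<Longrightarrow> smooth_on S f \<Longrightarrow> smooth_on S g \<Longrightarrow> smooth_on S (\<lambda>x. f x - g x)"
  using smooth_on_add[of S f "\<lambda>x. - g x"]
    smooth_on_bounded_linear[OF _ bounded_linear_minus[OF bounded_linear_ident], of S g] by simp

text \<open>In the chain rule the direction \<open>frechet_derivative f (at x) v\<close> varies with
  \<open>x\<close>, whereas \<open>Ck_on\<close> speaks of fixed directions. Expanding it in
  \<open>Basis\<close> leaves products of smooth coefficients with directional derivatives of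
  \<open>g\<close>, to which the induction hypothesis, general in \<open>g\<close>, applies; hence
  the Euclidean domain of \<open>g\<close>.\<close>

lemma Ck_on_compose:
  fixes g :: "'b::euclidean_space \<Rightarrow> 'c::real_normed_vector"
  assumes "open S" "smooth_on T g" "smooth_on S f" "f ` S \<subseteq> T"
  shows "Ck_on k S (\<lambda>x. g (f x))"
  using assms(2)
proof (induction k arbitrary: g)
  case 0
  then show ?case
    using continuous_on_compose2[OF smooth_on_continuous smooth_on_continuous[OF assms(3)] assms(4)] by simp
next
  case (Suc k)
  let ?D = "\<lambda>x v. frechet_derivative g (at (f x)) (frechet_derivative f (at x) v)"
  have der: "((\<lambda>x. g (f x)) has_derivative ?D x) (at x)" if "x \<in> S" for x
    using has_derivative_compose[OF smooth_on_SucD[OF assms(3) that], of g] smooth_on_SucD[OF Suc.prems] assms(4) that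
    by blast
  have eq: "?D x v = (\<Sum>b\<in>Basis. (frechet_derivative f (at x) v \<bullet> b) *\<^sub>R frechet_derivative g (at (f x)) b)"
    if "x \<in> S" for x v
  proof -
    have lin: "linear (frechet_derivative g (at (f x)))"
      using smooth_on_SucD[OF Suc.prems] assms(4) that has_derivative_linear by blast
    have "?D x v = frechet_derivative g (at (f x)) (\<Sum>b\<in>Basis. (frechet_derivative f (at x) v \<bullet> b) *\<^sub>R b)"
      by (simp add: euclidean_representation)
    also have "\<dots> = (\<Sum>b\<in>Basis. (frechet_derivative f (at x) v \<bullet> b) *\<^sub>R frechet_derivative g (at (f x)) b)"
      by (simp add: linear_sum[OF lin] linear_cmul[OF lin])
    finally show ?thesis .
  qed
  have "Ck_on k S (\<lambda>x. ?D x v)" for v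
  proof -
    have "Ck_on k S (\<lambda>x. \<Sum>b\<in>Basis. (frechet_derivative f (at x) v \<bullet> b) *\<^sub>R frechet_derivative g (at (f x)) b)"
      using smooth_on_deriv[OF assms(3), of v] Suc.IH[OF smooth_on_deriv[OF Suc.prems]]
      by (intro Ck_on_sum[OF assms(1)] Ck_on_bilinear[OF assms(1) bounded_bilinear_scaleR]
          Ck_on_bounded_linear[OF assms(1) bounded_linear_inner_left]) (auto simp: smooth_on_def)
    then show ?thesis by (rule Ck_on_cong[OF assms(1), THEN iffD2, rotated]) (rule eq)
  qed
  with der show ?case by (rule Ck_on_SucI[OF assms(1)])
qed

lemma smooth_on_compose:
  fixes g :: "'b::euclidean_space \<Rightarrow> 'c::real_normed_vector"
  shows "open S \<Longrightarrow> smooth_on T g \<Longrightarrow> smooth_on S f \<Longrightarrow> f ` S \<subseteq> T \<Longrightarrow> smooth_on S (\<lambda>x. g (f x))"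
  by (simp add: smooth_on_def[of S "\<lambda>x. g (f x)"] Ck_on_compose)

lemma smooth_on_holomorphic:
  assumes "open S" "f holomorphic_on S"
  shows "smooth_on S f"
proof -
  have "Ck_on k S f" for k
    using assms(2)
  proof (induction k arbitrary: f)
    case 0
    then show ?case by (simp add: holomorphic_on_imp_continuous_on)
  next
    case (Suc k)
    have "(f has_derivative (\<lambda>v. deriv f x * v)) (at x)" if "x \<in> S" for x
      using holomorphic_derivI[OF Suc.prems assms(1) that] by (simp add: has_field_derivative_def)
    moreover have "Ck_on k S (\<lambda>x. deriv f x * v)" for v
      by (rule Ck_on_bounded_linear[OF assms(1) bounded_linear_mult_left])
        (rule Suc.IH[OF holomorphic_deriv[OF Suc.prems assms(1)]])
    ultimately show ?case by (rule Ck_on_SucI[OF assms(1)])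
  qed
  then show ?thesis by (simp add: smooth_on_def)
qed

text \<open>In finite dimension an operator is the finite sum of the rank-one operators
  \<open>v \<mapsto> (v \<bullet> b) *\<^sub>R P x b\<close>, so smoothness on basis vectors gives
  smoothness in the operator norm.\<close>

lemma smooth_on_blinfunI:
  fixes P :: "'a::real_normed_vector \<Rightarrow> ('b::euclidean_space \<Rightarrow>\<^sub>L 'c::real_normed_vector)"
  assumes "open S" "\<And>v. smooth_on S (\<lambda>x. P x v)"
  shows "smooth_on S P"
proof -
  have *: "P x = (\<Sum>b\<in>Basis. blinfun_compose (blinfun_scaleR_left (P x b)) (blinfun_inner_left b))" for x
  proof (rule blinfun_eqI)
    fix v
    have "P x v = P x (\<Sum>b\<in>Basis. (v \<bullet> b) *\<^sub>R b)" by (simp add: euclidean_representation)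
    also have "\<dots> = (\<Sum>b\<in>Basis. blinfun_compose (blinfun_scaleR_left (P x b)) (blinfun_inner_left b)) v"
      by (simp add: blinfun.sum_left blinfun.sum_right blinfun.scaleR_right blinfun_inner_left.rep_eq)
    finally show "P x v = (\<Sum>b\<in>Basis. blinfun_compose (blinfun_scaleR_left (P x b)) (blinfun_inner_left b)) v" .
  qed
  have "bounded_linear (\<lambda>y. blinfun_compose (blinfun_scaleR_left y) (blinfun_inner_left b))" for b :: 'b
    by (rule bounded_linear_compose[OF bounded_bilinear.bounded_linear_left[OF bounded_bilinear_blinfun_compose]
          bounded_linear_blinfun_scaleR_left])
  then have "smooth_on S (\<lambda>x. blinfun_compose (blinfun_scaleR_left (P x b)) (blinfun_inner_left b))" for b
    by (rule smooth_on_bounded_linear[OF assms(1)]) (rule assms(2))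
  then have "smooth_on S (\<lambda>x. \<Sum>b\<in>Basis. blinfun_compose (blinfun_scaleR_left (P x b)) (blinfun_inner_left b))"
    by (intro smooth_on_sum[OF assms(1)])
  then show ?thesis by (simp only: *[symmetric])
qed

text \<open>Yields operator-norm continuity of a derivative, from which uniform bounds on compact
  sets follow.\<close>

lemma smooth_on_Blinfun_derivative:
  fixes f :: "'b::euclidean_space \<Rightarrow> 'c::real_normed_vector"
  assumes "open S" "smooth_on S f"
  shows "smooth_on S (\<lambda>x. Blinfun (frechet_derivative f (at x)))"
proof (rule smooth_on_blinfunI[OF assms(1)])
  fix v
  have "smooth_on S (\<lambda>x. frechet_derivative f (at x) v)" by (rule smooth_on_deriv[OF assms(2)])
  moreover have "Blinfun (frechet_derivative f (at x)) v = frechet_derivative f (at x) v" if "x \<in> S" for x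
    using has_derivative_bounded_linear[OF smooth_on_SucD[OF assms(2) that]] by (simp add: bounded_linear_Blinfun_apply)
  ultimately show "smooth_on S (\<lambda>x. Blinfun (frechet_derivative f (at x)) v)"
    by (rule smooth_on_cong[OF assms(1), THEN iffD2, rotated])
qed

section \<open>Hermitian and quaternionic algebra\<close>

lemma sum_prod_2: "(\<Sum>p\<in>(UNIV::('m::finite \<times> 2) set). f p) = (\<Sum>k\<in>UNIV. f (k, 1) + f (k, 2))"
  unfolding UNIV_Times_UNIV[symmetric] sum.cartesian_product' by (simp add: sum_2)

lemma herm_add_left: "herm (u + v) w = herm u w + herm v w"
  by (simp add: herm_def sum.distrib distrib_right)

lemma herm_smult_left: "herm (a *s v) w = a * herm v w"
  by (simp add: herm_def sum_distrib_left mult.assoc)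

lemma herm_cnj: "cnj (herm v w) = herm w v"
  by (simp add: herm_def mult.commute)

lemma herm_add_right: "herm w (u + v) = herm w u + herm w v"
  by (simp add: herm_def sum.distrib distrib_left)

lemma herm_smult_right: "herm v (a *s w) = cnj a * herm v w"
  by (simp add: herm_def sum_distrib_left mult_ac)

lemma scaleR_eq_smult: "r *\<^sub>R v = complex_of_real r *s (v :: complex ^ 'k::finite)"
  unfolding vec_eq_iff vector_scaleR_component vector_smult_component by (simp add: scaleR_conv_of_real)

lemma herm_zero_left [simp]: "herm 0 w = 0" and herm_zero_right [simp]: "herm w 0 = 0"
  by (simp_all add: herm_def)

lemma herm_minus_left: "herm (- v) w = - herm v w"
  by (simp add: herm_def sum_negf)

lemma herm_diff_left: "herm (u - v) w = herm u w - herm v w"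
  by (simp add: herm_def sum_subtractf left_diff_distrib)

lemma Re_herm: "Re (herm v w) = v \<bullet> w"
  by (simp add: herm_def inner_vec_def inner_complex_def)

lemma Im_herm: "Im (herm v w) = v \<bullet> (\<i> *s w)"
  unfolding Re_herm[symmetric] by (simp add: herm_smult_right)

lemma herm_self: "herm v v = complex_of_real (v \<bullet> v)"
proof (rule complex_eqI)
  have "Im (herm v v) = Im (cnj (herm v v))" by (simp only: herm_cnj)
  then show "Im (herm v v) = Im (complex_of_real (v \<bullet> v))" by simp
qed (simp add: Re_herm)

lemma jmul_add: "jmul (u + v) = jmul u + jmul v"
  by (simp add: jmul_def vec_eq_iff)

lemma jmul_zero [simp]: "jmul 0 = 0"
  by (simp add: jmul_def vec_eq_iff)

lemma jmul_smult: "jmul (a *s v) = cnj a *s jmul v"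
  by (simp add: jmul_def vec_eq_iff)

lemma jmul_jmul [simp]: "jmul (jmul v) = - v"
proof -
  have "snd p \<noteq> 1 \<Longrightarrow> p = (fst p, 2)" "snd p = 1 \<Longrightarrow> p = (fst p, 1)" for p :: "'a \<times> 2"
    using exhaust_2[of "snd p"] by (auto simp: prod_eq_iff)
  then show ?thesis by (auto simp: jmul_def vec_eq_iff)
qed

lemma herm_jmul_jmul: "herm (jmul v) (jmul w) = herm w v"
  by (simp add: herm_def sum_prod_2 jmul_def algebra_simps)

text \<open>\<open>herm v (jmul w)\<close> is the complex symplectic form: complex bilinear and
  skew. Its real and imaginary parts are, up to sign, \<open>\<omega>\<^sub>J\<close> and
  \<open>\<omega>\<^sub>K\<close>.\<close>

lemma herm_jmul_right: "herm v (jmul w) = - herm w (jmul v)"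
  using herm_jmul_jmul[of "jmul w" v] by (simp add: herm_minus_left)

lemma herm_jmul_left: "herm (jmul v) w = - herm (jmul w) v"
  by (metis herm_jmul_right herm_cnj complex_cnj_minus)

lemma herm_jmul_self [simp]: "herm v (jmul v) = 0" "herm (jmul v) v = 0"
  using herm_jmul_right[of v v] herm_jmul_left[of v v] by (simp_all add: eq_neg_iff_add_eq_0)

lemma inner_jmul_jmul: "jmul v \<bullet> jmul w = v \<bullet> w"
  unfolding Re_herm[symmetric] herm_jmul_jmul by (simp add: Re_herm inner_commute)

lemma bounded_linear_jmul: "bounded_linear jmul"
  by (rule linear_conv_bounded_linear[THEN iffD1], rule linearI)
    (simp_all add: jmul_add scaleR_eq_smult jmul_smult)

lemma bounded_bilinear_herm: "bounded_bilinear (herm :: complex ^ 'k::finite \<Rightarrow> _)"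
  by (rule bilinear_conv_bounded_bilinear[THEN iffD1])
    (auto simp: bilinear_def intro!: linearI
      simp: herm_add_left herm_add_right scaleR_eq_smult herm_smult_left herm_smult_right scaleR_conv_of_real)

lemma bounded_bilinear_smult: "bounded_bilinear ((*s) :: complex \<Rightarrow> complex ^ 'k::finite \<Rightarrow> _)"
  by (rule bilinear_conv_bounded_bilinear[THEN iffD1])
    (auto simp: bilinear_def intro!: linearI simp: vec_eq_iff algebra_simps)

section \<open>Horizontal spaces and quaternionic lines\<close>

lemma subspace_hp_hor: "subspace (hp_hor q)"
  by (auto simp: subspace_def hp_hor_def herm_add_left scaleR_eq_smult herm_smult_left)

lemma subspace_cp_hor: "subspace (cp_hor q)"
  by (auto simp: subspace_def cp_hor_def herm_add_left scaleR_eq_smult herm_smult_left)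

lemma smult_mem_hp_hor: "v \<in> hp_hor q \<Longrightarrow> a *s v \<in> hp_hor q"
  by (simp add: hp_hor_def herm_smult_left)

lemma jmul_mem_hp_hor: "v \<in> hp_hor q \<Longrightarrow> jmul v \<in> hp_hor q"
  using herm_cnj[of v q] herm_cnj[of v "jmul q"] herm_jmul_left[of v q] herm_jmul_jmul[of v q]
  by (simp add: hp_hor_def)

lemma hline_self: "v \<in> hline v"
proof -
  have "v = 1 *s v + 0 *s jmul v" by simp
  then show ?thesis unfolding hline_def by blast
qed

lemma subspace_hline: "subspace (hline h)"
proof (rule subspaceI)
  show "0 \<in> hline h" unfolding hline_def by (rule CollectI, rule exI[of _ 0], rule exI[of _ 0]) simp
  show "x + y \<in> hline h" if xy: "x \<in> hline h" "y \<in> hline h" for x y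
  proof -
    obtain a b c d where "x = a *s h + b *s jmul h" "y = c *s h + d *s jmul h"
      using xy unfolding hline_def by blast
    then have "x + y = (a + c) *s h + (b + d) *s jmul h" by (simp add: vector_sadd_rdistrib)
    then show ?thesis unfolding hline_def by blast
  qed
  show "r *\<^sub>R x \<in> hline h" if x: "x \<in> hline h" for r x
  proof -
    obtain a b where "x = a *s h + b *s jmul h" using x unfolding hline_def by blast
    then have "r *\<^sub>R x = (of_real r * a) *s h + (of_real r * b) *s jmul h"
      by (simp add: scaleR_eq_smult vector_add_ldistrib vector_smult_assoc)
    then show ?thesis unfolding hline_def by blast
  qed
qed

lemma hline_subset:
  assumes "v \<in> hline h" shows "hline v \<subseteq> hline h"
proof
  obtain a b where v: "v = a *s h + b *s jmul h" using assms unfolding hline_def by blast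
  fix x assume "x \<in> hline v"
  then obtain c d where x: "x = c *s v + d *s jmul v" unfolding hline_def by blast
  \<comment> \<open>The coefficients are those of the quaternion product of \<open>c + d j\<close>
    and \<open>a + b j\<close>.\<close>
  have "x = (c * a - d * cnj b) *s h + (c * b + d * cnj a) *s jmul h"
    by (simp add: x v jmul_add jmul_smult vec_eq_iff algebra_simps)
  then show "x \<in> hline h" unfolding hline_def by blast
qed

text \<open>Nonzero quaternions are invertible: \<open>cnj a - b j\<close> is the conjugate of
  \<open>a + b j\<close>, and \<open>n\<close> in the proof is the squared norm.\<close>

lemma hline_eq:
  assumes "v \<in> hline h" "v \<noteq> 0" shows "hline v = hline h"
proof
  show "hline v \<subseteq> hline h" by (rule hline_subset[OF assms(1)])
  obtain a b where v: "v = a *s h + b *s jmul h" using assms unfolding hline_def by blast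
  define n where "n = a * cnj a + b * cnj b"
  have n: "n = complex_of_real ((cmod a)\<^sup>2 + (cmod b)\<^sup>2)"
    unfolding n_def of_real_add complex_norm_square ..
  have "n \<noteq> 0"
  proof
    assume "n = 0"
    then have "(cmod a)\<^sup>2 + (cmod b)\<^sup>2 = 0" unfolding n of_real_eq_0_iff .
    then have "a = 0" "b = 0" by (simp_all add: sum_power2_eq_zero_iff)
    with v assms(2) show False by simp
  qed
  have "cnj a *s v - b *s jmul v = n *s h"
    by (simp add: v n_def jmul_add jmul_smult vec_eq_iff algebra_simps)
  then have "h = inverse n *s (cnj a *s v - b *s jmul v)"
    using \<open>n \<noteq> 0\<close> by (simp add: vector_smult_assoc)
  also have "\<dots> = (inverse n * cnj a) *s v + (- inverse n * b) *s jmul v"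
    by (simp add: vec_eq_iff algebra_simps)
  finally have "h \<in> hline v" unfolding hline_def by blast
  then show "hline h \<subseteq> hline v" by (rule hline_subset)
qed

section \<open>Orthogonal projections onto lines and horizontal spaces\<close>

lemma closest_point_subspace:
  fixes S :: "'e::euclidean_space set"
  assumes S: "subspace S" and p: "p \<in> S" and orth: "\<And>z. z \<in> S \<Longrightarrow> (v - p) \<bullet> z = 0"
  shows "closest_point S v = p"
proof (rule closest_point_unique[symmetric])
  show "convex S" "closed S" by (simp_all add: S subspace_imp_convex closed_subspace)
  show "\<forall>z\<in>S. dist v p \<le> dist v z"
  proof
    fix z assume "z \<in> S"
    then have "orthogonal (v - p) (p - z)"
      using orth subspace_diff[OF S p] by (simp add: orthogonal_def)
    then have "(norm (v - p + (p - z)))\<^sup>2 = (norm (v - p))\<^sup>2 + (norm (p - z))\<^sup>2"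
      by (rule norm_add_Pythagorean)
    then have "(norm (v - p))\<^sup>2 \<le> (norm (v - z))\<^sup>2" by simp
    then show "dist v p \<le> dist v z" unfolding dist_norm by (rule power2_le_imp_le) (rule norm_ge_zero)
  qed
qed (rule p)

text \<open>This and \<open>hp_part\<close> leave out the division by \<open>n \<bullet> n\<close>.
  They are thus quadratic in \<open>n\<close> and make sense at \<open>n = 0\<close>, which occurs
  when \<open>n\<close> is the coordinate of the centre of a chart.\<close>

definition cp_part :: "complex ^ ('m::finite \<times> 2) \<Rightarrow> complex ^ ('m \<times> 2) \<Rightarrow> complex ^ ('m \<times> 2)" where
  "cp_part n v = herm v n *s n"

definition hp_part :: "complex ^ ('m::finite \<times> 2) \<Rightarrow> complex ^ ('m \<times> 2) \<Rightarrow> complex ^ ('m \<times> 2)" where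
  "hp_part n v = herm v n *s n + herm v (jmul n) *s jmul n"

text \<open>\<open>n\<close> and \<open>jmul n\<close> are Hermitian orthogonal and of equal length,
  so the projection onto their complex span is the sum of the projections onto the two complex
  lines.\<close>

lemma closest_point_hline:
  assumes "n \<noteq> 0"
  shows "closest_point (hline n) v = (1 / (n \<bullet> n)) *\<^sub>R hp_part n v"
proof (rule closest_point_subspace[OF subspace_hline])
  have "(1 / (n \<bullet> n)) *\<^sub>R hp_part n v =
      (of_real (1 / (n \<bullet> n)) * herm v n) *s n + (of_real (1 / (n \<bullet> n)) * herm v (jmul n)) *s jmul n"
    by (simp add: hp_part_def scaleR_eq_smult vector_add_ldistrib vector_smult_assoc del: of_real_divide)
  then show "(1 / (n \<bullet> n)) *\<^sub>R hp_part n v \<in> hline n" unfolding hline_def by blast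
  fix z assume "z \<in> hline n"
  then obtain a b where z: "z = a *s n + b *s jmul n" unfolding hline_def by blast
  have "herm (v - (1 / (n \<bullet> n)) *\<^sub>R hp_part n v) z = 0"
    using assms unfolding z hp_part_def scaleR_eq_smult
    by (simp add: herm_diff_left herm_add_left herm_add_right herm_smult_left herm_smult_right herm_jmul_jmul herm_self inner_jmul_jmul)
  then show "(v - (1 / (n \<bullet> n)) *\<^sub>R hp_part n v) \<bullet> z = 0" unfolding Re_herm[symmetric] by simp
qed

lemma closest_point_hp_hor:
  assumes "n \<noteq> 0"
  shows "closest_point (hp_hor n) v = v - (1 / (n \<bullet> n)) *\<^sub>R hp_part n v"
proof (rule closest_point_subspace[OF subspace_hp_hor])
  show "v - (1 / (n \<bullet> n)) *\<^sub>R hp_part n v \<in> hp_hor n"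
    using assms unfolding hp_hor_def hp_part_def scaleR_eq_smult
    by (simp add: herm_diff_left herm_add_left herm_smult_left herm_jmul_jmul herm_self inner_jmul_jmul)
  fix z assume "z \<in> hp_hor n"
  then have z: "herm n z = 0" "herm (jmul n) z = 0"
    unfolding hp_hor_def by (metis (mono_tags, lifting) mem_Collect_eq herm_cnj complex_cnj_zero)+
  have "herm (v - (v - (1 / (n \<bullet> n)) *\<^sub>R hp_part n v)) z = 0"
    by (simp add: hp_part_def scaleR_eq_smult herm_add_left herm_smult_left z)
  then show "(v - (v - (1 / (n \<bullet> n)) *\<^sub>R hp_part n v)) \<bullet> z = 0" unfolding Re_herm[symmetric] by simp
qed

lemma closest_point_cp_hor:
  assumes "n \<noteq> 0"
  shows "closest_point (cp_hor n) v = v - (1 / (n \<bullet> n)) *\<^sub>R cp_part n v"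
proof (rule closest_point_subspace[OF subspace_cp_hor])
  show "v - (1 / (n \<bullet> n)) *\<^sub>R cp_part n v \<in> cp_hor n"
    using assms unfolding cp_hor_def cp_part_def scaleR_eq_smult
    by (simp add: herm_diff_left herm_add_left herm_smult_left herm_self)
  fix z assume "z \<in> cp_hor n"
  then have z: "herm n z = 0"
    unfolding cp_hor_def by (metis (mono_tags, lifting) mem_Collect_eq herm_cnj complex_cnj_zero)
  have "herm (v - (v - (1 / (n \<bullet> n)) *\<^sub>R cp_part n v)) z = 0"
    by (simp add: cp_part_def scaleR_eq_smult herm_smult_left z)
  then show "(v - (v - (1 / (n \<bullet> n)) *\<^sub>R cp_part n v)) \<bullet> z = 0" unfolding Re_herm[symmetric] by simp
qed

section \<open>Affine charts of projective spaces\<close>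

text \<open>\<open>T n\<close> is \<open>|n|\<^sup>2\<close> times the orthogonal projection onto \<open>L n\<close>.\<close>

locale line_quotient =
  fixes L :: "'e::euclidean_space \<Rightarrow> 'e set" and H :: "'e \<Rightarrow> 'e set" and T :: "'e \<Rightarrow> 'e \<Rightarrow> 'e"
  assumes subspace_H: "subspace (H n)"
    and H_scale: "c \<noteq> 0 \<Longrightarrow> H (c *\<^sub>R n) = H n"
    and H_orth: "w \<in> H q \<Longrightarrow> w \<bullet> q = 0"
    and chart_inj: "norm q = 1 \<Longrightarrow> inj_on (\<lambda>w. L (q + w)) (H q)"
    and closest_point_H: "n \<noteq> 0 \<Longrightarrow> closest_point (H n) v = v - (1 / (n \<bullet> n)) *\<^sub>R T n v"
    and linear_T: "linear (T n)"
    and T_T: "T n (T n v) = (n \<bullet> n) *\<^sub>R T n v"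
    and T_adj: "T n u \<bullet> v = u \<bullet> T n v"
    and T_self: "T n n = (n \<bullet> n) *\<^sub>R n"
    and T_scale: "T (c *\<^sub>R n) u = c\<^sup>2 *\<^sub>R T n u"
    and T_shift: "w \<in> H q \<Longrightarrow> u \<in> H q \<Longrightarrow> v \<in> H q \<Longrightarrow> T (q + w) u \<bullet> v = T w u \<bullet> v"
begin

text \<open>Exhibits \<open>H q\<close> as the kernel of a linear map, so that membership can be
  differentiated. A vector is its own closest point in \<open>H q\<close> exactly when the
  correction \<open>T q v\<close> vanishes.\<close>

lemma mem_H_iff: "q \<noteq> 0 \<Longrightarrow> v \<in> H q \<longleftrightarrow> T q v = 0"
  using closest_point_H[of q v] closest_point_self[of v "H q"]
    closest_point_in_set[OF closed_subspace[OF subspace_H], of q v] subspace_0[OF subspace_H, of q]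
  by (cases "H q = {}") auto

lemma derivative_in_H:
  assumes "norm q = 1" "open U" "p \<in> U" "\<And>x. x \<in> U \<Longrightarrow> w x \<in> H q" "(w has_derivative D) (at p)"
  shows "D X \<in> H q"
proof -
  have q: "q \<noteq> 0" using assms(1) by auto
  have "((\<lambda>x. T q (w x)) has_derivative (\<lambda>X. T q (D X))) (at p)"
    by (rule bounded_linear.has_derivative[OF _ assms(5)]) (simp add: linear_T linear_conv_bounded_linear[symmetric])
  moreover have "((\<lambda>x. T q (w x)) has_derivative (\<lambda>X. 0)) (at p)"
    by (rule has_derivative_transform_within_open[OF has_derivative_const[of 0] assms(2,3)])
      (use assms(4) mem_H_iff[OF q] in auto)
  ultimately have "(\<lambda>X. T q (D X)) = (\<lambda>X. 0)" by (rule has_derivative_unique)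
  then show ?thesis using mem_H_iff[OF q] by metis
qed

lemma coord_eq: "norm q = 1 \<Longrightarrow> w \<in> H q \<Longrightarrow> coord L H q (L (q + w)) = w"
  unfolding coord_def by (rule inv_into_f_f[OF chart_inj])

lemma coord_base: "norm q = 1 \<Longrightarrow> coord L H q (L q) = 0"
  using coord_eq[of q 0] subspace_0[OF subspace_H] by simp

text \<open>This is the Fubini-Study formula in an affine chart, together with its quaternionic
  analogue. Differentiating \<open>sgn (q + w)\<close> gives \<open>u\<close> divided by the norm of
  \<open>q + w\<close>, plus a multiple of \<open>q + w\<close>; the projection to the horizontal
  space removes that multiple.\<close>

lemma quot_metric_eq:
  assumes q: "norm q = 1" and w: "w \<in> H q" and u: "u \<in> H q" and v: "v \<in> H q"
  shows "quot_metric H q w u v = (u \<bullet> v) / (1 + w \<bullet> w) - (T w u \<bullet> v) / (1 + w \<bullet> w)\<^sup>2"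
proof -
  define n where "n = q + w"
  have N: "n \<bullet> n = 1 + w \<bullet> w"
    using H_orth[OF w] q by (simp add: n_def inner_add inner_commute dot_square_norm[of q])
  have N0: "1 + w \<bullet> w > 0" by (rule add_pos_nonneg) auto
  have n0: "n \<noteq> 0" using N N0 by auto
  define \<alpha> where "\<alpha> = inverse (norm n)"
  have \<alpha>2: "\<alpha>\<^sup>2 = 1 / (1 + w \<bullet> w)"
    unfolding \<alpha>_def power_inverse power2_norm_eq_inner N by (rule inverse_eq_divide)
  have lift: "hor_lift H q w x = \<alpha> *\<^sub>R (x - (1 / (n \<bullet> n)) *\<^sub>R T n x)" for x
  proof -
    have "(\<lambda>y. inverse (norm (q + y))) differentiable (at w)"
      by (intro differentiable_inverse differentiable_compose[of norm "\<lambda>y. q + y"] differentiable_norm_at derivative_intros)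
        (use n0 in \<open>simp_all add: n_def\<close>)
    then obtain f' where f': "((\<lambda>y. inverse (norm (q + y))) has_derivative f') (at w)"
      unfolding differentiable_def by blast
    have "((\<lambda>y. q + y) has_derivative (\<lambda>h. h)) (at w)" by (auto intro!: derivative_eq_intros)
    from has_derivative_scaleR[OF f' this]
    have "((\<lambda>y. sgn (q + y)) has_derivative (\<lambda>h. \<alpha> *\<^sub>R h + f' h *\<^sub>R n)) (at w)"
      by (simp add: sgn_div_norm \<alpha>_def n_def)
    then have fd: "frechet_derivative (\<lambda>y. sgn (q + y)) (at w) x = \<alpha> *\<^sub>R x + f' x *\<^sub>R n"
      using frechet_derivative_at by metis
    have Hs: "H (sgn n) = H n" using H_scale[of "inverse (norm n)" n] n0 by (simp add: sgn_div_norm)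
    show ?thesis
      unfolding hor_lift_def fd n_def[symmetric] Hs closest_point_H[OF n0]
      using n0 by (simp add: linear_add[OF linear_T] linear_cmul[OF linear_T] T_self algebra_simps)
  qed
  have TT: "T n u \<bullet> T n v = (n \<bullet> n) * (T n u \<bullet> v)"
    using T_adj[of n "T n u" v] by (simp add: T_T)
  have "quot_metric H q w u v = \<alpha>\<^sup>2 * ((u - (1 / (n \<bullet> n)) *\<^sub>R T n u) \<bullet> (v - (1 / (n \<bullet> n)) *\<^sub>R T n v))"
    by (simp add: quot_metric_def lift power2_eq_square)
  also have "(u - (1 / (n \<bullet> n)) *\<^sub>R T n u) \<bullet> (v - (1 / (n \<bullet> n)) *\<^sub>R T n v) = u \<bullet> v - (T n u \<bullet> v) / (n \<bullet> n)"
    using n0 T_adj[of n u v] by (simp add: inner_diff_left inner_diff_right TT)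
  \<comment> \<open>Horizontality of \<open>u\<close> and \<open>v\<close> at \<open>q\<close>
    removes the \<open>q\<close> part of \<open>n\<close>, and what remains is quadratic in the
    coordinate \<open>w\<close>.\<close>
  also have "T n u \<bullet> v = T w u \<bullet> v" unfolding n_def by (rule T_shift[OF w u v])
  finally show ?thesis unfolding \<alpha>2 N by (simp add: right_diff_distrib power2_eq_square)
qed

lemma T_zero [simp]: "T 0 u = 0"
  using T_scale[of 0 0 u] by simp

lemma quot_metric_base:
  "norm q = 1 \<Longrightarrow> u \<in> H q \<Longrightarrow> v \<in> H q \<Longrightarrow> quot_metric H q 0 u v = u \<bullet> v"
  using quot_metric_eq[of q 0 u v] subspace_0[OF subspace_H] by simp

text \<open>Along \<open>t *\<^sub>R u\<close> the metric is a function of \<open>t\<^sup>2\<close>,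
  because \<open>T\<close> is quadratic in its first argument; so its derivative at
  \<open>t = 0\<close> vanishes.\<close>

lemma dir_deriv_quot_metric_base:
  assumes q: "norm q = 1" and u: "u \<in> H q" and v: "v \<in> H q" and x: "x \<in> H q"
  shows "dir_deriv (\<lambda>y. quot_metric H q y v x) 0 u = 0"
proof -
  have pos: "1 + t\<^sup>2 * (u \<bullet> u) \<noteq> 0" for t
    by (metis add_pos_nonneg inner_ge_zero less_numeral_extra(1) mult_nonneg_nonneg order_less_irrefl zero_le_power2)
  have eq: "quot_metric H q (0 + t *\<^sub>R u) v x =
      (v \<bullet> x) / (1 + t\<^sup>2 * (u \<bullet> u)) - t\<^sup>2 * (T u v \<bullet> x) / (1 + t\<^sup>2 * (u \<bullet> u))\<^sup>2" for t
    using quot_metric_eq[OF q subspace_scale[OF subspace_H u, of t] v x]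
    by (simp add: T_scale power2_eq_square mult.assoc)
  have "((\<lambda>t. (v \<bullet> x) / (1 + t\<^sup>2 * (u \<bullet> u)) - t\<^sup>2 * (T u v \<bullet> x) / (1 + t\<^sup>2 * (u \<bullet> u))\<^sup>2)
      has_field_derivative 0) (at 0)"
    by (rule derivative_eq_intros refl | simp add: pos)+
  then show ?thesis unfolding dir_deriv_def eq by (rule DERIV_imp_deriv)
qed

text \<open>All first derivatives of the metric vanish at the centre, so the right side of Koszul's
  formula is zero. Uniqueness for \<open>THE\<close> comes from testing with \<open>x = c\<close>,
  where the metric is the inner product.\<close>

lemma christoffel_base:
  assumes q: "norm q = 1" and u: "u \<in> H q" and v: "v \<in> H q"
  shows "christoffel (H q) (quot_metric H q) 0 u v = 0"
  unfolding christoffel_def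
proof (rule the_equality)
  show "0 \<in> H q \<and> (\<forall>x\<in>H q. 2 * quot_metric H q 0 0 x =
      dir_deriv (\<lambda>y. quot_metric H q y v x) 0 u + dir_deriv (\<lambda>y. quot_metric H q y u x) 0 v - dir_deriv (\<lambda>y. quot_metric H q y u v) 0 x)"
    using subspace_0[OF subspace_H, of q] u v q by (simp add: dir_deriv_quot_metric_base quot_metric_base)
  fix c
  assume c: "c \<in> H q \<and> (\<forall>x\<in>H q. 2 * quot_metric H q 0 c x =
      dir_deriv (\<lambda>y. quot_metric H q y v x) 0 u + dir_deriv (\<lambda>y. quot_metric H q y u x) 0 v - dir_deriv (\<lambda>y. quot_metric H q y u v) 0 x)"
  then have "2 * quot_metric H q 0 c c = 0" using u v q by (simp add: dir_deriv_quot_metric_base)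
  then show "c = 0" using c q by (simp add: quot_metric_base)
qed

text \<open>\<open>coord\<close> is an \<open>inv_into\<close> and carries no information outside
  the chart domain; on \<open>U\<close> its values do lie in \<open>H q\<close> and represent
  \<open>f\<close>.\<close>

lemma chart_at:
  assumes "smooth_map L H M f" "p \<in> M" "norm q = 1" "L q = f p"
  obtains U w where "open U" "p \<in> U" "U \<subseteq> M" "smooth_on U w" "\<And>x. x \<in> U \<Longrightarrow> w x \<in> H q"
    "\<And>x. x \<in> U \<Longrightarrow> f x = L (q + w x)" "\<And>x. x \<in> U \<Longrightarrow> coord L H q (f x) = w x" "w p = 0"
    "\<And>x Z. x \<in> U \<Longrightarrow> diff_map L H q f x Z = frechet_derivative w (at x) Z"
proof -
  obtain U where U: "open U" "p \<in> U" "U \<subseteq> M" "f ` U \<subseteq> chart_dom L H q" "smooth_on U (\<lambda>x. coord L H q (f x))"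
    using assms unfolding smooth_map_def by (metis mem_sphere_0)
  have "\<exists>w\<in>H q. f x = L (q + w)" if "x \<in> U" for x
    using U(4) that unfolding chart_dom_def by auto
  then have "coord L H q (f x) \<in> H q \<and> f x = L (q + coord L H q (f x))" if "x \<in> U" for x
    using that coord_eq[OF assms(3)] by metis
  moreover have "coord L H q (f p) = 0" using coord_base[OF assms(3)] assms(4) by simp
  ultimately show thesis using that[OF U(1-3,5)] by (simp add: diff_map_def)
qed

text \<open>With no Christoffel term of the target at the centre, comparing second fundamental forms
  in two targets amounts to comparing 2-jets of coordinate functions.\<close>

lemma second_ff_eq:
  assumes q: "norm q = 1" and f: "f p = L q" and U: "open U" "p \<in> U"
    and w: "\<And>x. x \<in> U \<Longrightarrow> w x \<in> H q" "\<And>x. x \<in> U \<Longrightarrow> coord L H q (f x) = w x"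
    and sm: "smooth_on U w"
  shows "second_ff L H g q f p X Y =
    frechet_derivative (\<lambda>x. frechet_derivative w (at x) Y) (at p) X
    - frechet_derivative w (at p) (christoffel UNIV g p X Y)"
proof -
  have d: "diff_map L H q f x Z = frechet_derivative w (at x) Z" if "x \<in> U" for x Z
    unfolding diff_map_def using frechet_cong_open(2)[OF U(1) that, of "\<lambda>x. coord L H q (f x)" w] w(2) by simp
  have dH: "frechet_derivative w (at p) Z \<in> H q" for Z
    using derivative_in_H[OF q U w(1) smooth_on_SucD[OF sm U(2)]] .
  have "frechet_derivative (\<lambda>x. diff_map L H q f x Y) (at p) = frechet_derivative (\<lambda>x. frechet_derivative w (at x) Y) (at p)"
    by (rule frechet_cong_open(2)[OF U]) (rule d)
  then show ?thesis
    unfolding second_ff_def f coord_base[OF q] d[OF U(2)] christoffel_base[OF q dH dH] by simp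
qed

end

interpretation hp: line_quotient "hline :: complex ^ ('m::finite \<times> 2) \<Rightarrow> _" hp_hor hp_part
proof (rule line_quotient.intro)
  fix n v u w q :: "complex ^ ('m \<times> 2)" and c :: real
  show "subspace (hp_hor n)" by (rule subspace_hp_hor)
  show "c \<noteq> 0 \<Longrightarrow> hp_hor (c *\<^sub>R n) = hp_hor n"
    by (simp add: hp_hor_def scaleR_eq_smult jmul_smult herm_smult_right)
  show "w \<in> hp_hor q \<Longrightarrow> w \<bullet> q = 0" by (simp add: hp_hor_def Re_herm[symmetric])
  show "n \<noteq> 0 \<Longrightarrow> closest_point (hp_hor n) v = v - (1 / (n \<bullet> n)) *\<^sub>R hp_part n v"
    by (rule closest_point_hp_hor)
  show "linear (hp_part n)"
    by (rule linearI)
      (simp_all add: hp_part_def scaleR_eq_smult herm_add_left herm_smult_left vector_sadd_rdistrib vector_add_ldistrib vector_smult_assoc)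
  show "hp_part n (hp_part n v) = (n \<bullet> n) *\<^sub>R hp_part n v"
    by (simp add: hp_part_def scaleR_eq_smult herm_add_left herm_smult_left herm_self inner_jmul_jmul
        vector_add_ldistrib vector_smult_assoc mult.commute)
  have "herm (hp_part n u) v = herm u (hp_part n v)"
    by (simp add: hp_part_def herm_add_left herm_smult_left herm_add_right herm_smult_right herm_cnj)
  then show "hp_part n u \<bullet> v = u \<bullet> hp_part n v" unfolding Re_herm[symmetric] by simp
  show "hp_part n n = (n \<bullet> n) *\<^sub>R n" by (simp add: hp_part_def scaleR_eq_smult herm_self)
  show "hp_part (c *\<^sub>R n) u = c\<^sup>2 *\<^sub>R hp_part n u"
    by (simp add: hp_part_def scaleR_eq_smult jmul_smult herm_smult_right vector_add_ldistrib vector_smult_assoc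
        power2_eq_square mult_ac)
  show "hp_part (q + w) u \<bullet> v = hp_part w u \<bullet> v" if "w \<in> hp_hor q" "u \<in> hp_hor q" "v \<in> hp_hor q"
  proof -
    have "herm u q = 0" "herm u (jmul q) = 0" "herm q v = 0" "herm (jmul q) v = 0"
      using that herm_cnj[of v q] herm_cnj[of v "jmul q"] by (simp_all add: hp_hor_def)
    then have "herm (hp_part (q + w) u) v = herm (hp_part w u) v"
      by (simp add: hp_part_def jmul_add herm_add_left herm_add_right herm_smult_left)
    then show ?thesis unfolding Re_herm[symmetric] by simp
  qed
  show "inj_on (\<lambda>w. hline (q + w)) (hp_hor q)" if q: "norm q = 1"
  proof (rule inj_onI)
    fix x y assume x: "x \<in> hp_hor q" and y: "y \<in> hp_hor q" and eq: "hline (q + x) = hline (q + y)"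
    have "q + y \<in> hline (q + x)" using eq hline_self by blast
    then obtain a b where ab: "q + y = a *s (q + x) + b *s jmul (q + x)" unfolding hline_def by blast
    have "q \<bullet> q = 1" using q by (simp add: dot_square_norm)
    then have qq: "herm q q = 1" "herm (jmul q) (jmul q) = 1"
      by (simp_all add: herm_self inner_jmul_jmul)
    have h: "herm x q = 0" "herm x (jmul q) = 0" "herm y q = 0" "herm y (jmul q) = 0"
        "herm (jmul x) q = 0" "herm (jmul x) (jmul q) = 0"
      using x y jmul_mem_hp_hor[OF x] by (simp_all add: hp_hor_def)
    \<comment> \<open>Pairing with \<open>q\<close> and \<open>jmul q\<close> reads off the two
      complex coordinates of the quaternion factor, and for a chart point \<open>q + y\<close> these
      are \<open>1\<close> and \<open>0\<close>.\<close>
    have "herm (q + y) q = a" "herm (q + y) (jmul q) = b"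
      unfolding ab by (simp_all add: herm_add_left herm_smult_left jmul_add qq h)
    then have "a = 1" "b = 0" by (simp_all add: herm_add_left qq h)
    then show "x = y" using ab by simp
  qed
qed

interpretation cp: line_quotient "cline :: complex ^ ('m::finite \<times> 2) \<Rightarrow> _" cp_hor cp_part
proof (rule line_quotient.intro)
  fix n v u w q :: "complex ^ ('m \<times> 2)" and c :: real
  show "subspace (cp_hor n)" by (rule subspace_cp_hor)
  show "c \<noteq> 0 \<Longrightarrow> cp_hor (c *\<^sub>R n) = cp_hor n"
    by (simp add: cp_hor_def scaleR_eq_smult herm_smult_right)
  show "w \<in> cp_hor q \<Longrightarrow> w \<bullet> q = 0" by (simp add: cp_hor_def Re_herm[symmetric])
  show "n \<noteq> 0 \<Longrightarrow> closest_point (cp_hor n) v = v - (1 / (n \<bullet> n)) *\<^sub>R cp_part n v"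
    by (rule closest_point_cp_hor)
  show "linear (cp_part n)"
    by (rule linearI)
      (simp_all add: cp_part_def scaleR_eq_smult herm_add_left herm_smult_left vector_sadd_rdistrib vector_smult_assoc)
  show "cp_part n (cp_part n v) = (n \<bullet> n) *\<^sub>R cp_part n v"
    by (simp add: cp_part_def scaleR_eq_smult herm_smult_left herm_self vector_smult_assoc mult.commute)
  have "herm (cp_part n u) v = herm u (cp_part n v)"
    by (simp add: cp_part_def herm_smult_left herm_smult_right herm_cnj)
  then show "cp_part n u \<bullet> v = u \<bullet> cp_part n v" unfolding Re_herm[symmetric] by simp
  show "cp_part n n = (n \<bullet> n) *\<^sub>R n" by (simp add: cp_part_def scaleR_eq_smult herm_self)
  show "cp_part (c *\<^sub>R n) u = c\<^sup>2 *\<^sub>R cp_part n u"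
    by (simp add: cp_part_def scaleR_eq_smult herm_smult_right vector_smult_assoc power2_eq_square mult_ac)
  show "cp_part (q + w) u \<bullet> v = cp_part w u \<bullet> v" if "w \<in> cp_hor q" "u \<in> cp_hor q" "v \<in> cp_hor q"
  proof -
    have "herm u q = 0" "herm q v = 0"
      using that herm_cnj[of v q] by (simp_all add: cp_hor_def)
    then have "herm (cp_part (q + w) u) v = herm (cp_part w u) v"
      by (simp add: cp_part_def herm_add_left herm_add_right herm_smult_left)
    then show ?thesis unfolding Re_herm[symmetric] by simp
  qed
  show "inj_on (\<lambda>w. cline (q + w)) (cp_hor q)" if q: "norm q = 1"
  proof (rule inj_onI)
    fix x y assume x: "x \<in> cp_hor q" and y: "y \<in> cp_hor q" and eq: "cline (q + x) = cline (q + y)"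
    have "q + y \<in> cline (q + y)" unfolding cline_def by (auto intro!: exI[of _ 1])
    then obtain a where a: "q + y = a *s (q + x)" using eq unfolding cline_def by blast
    have qq: "herm q q = 1" using q by (simp add: herm_self dot_square_norm)
    have h: "herm x q = 0" "herm y q = 0" using x y by (simp_all add: cp_hor_def)
    have "herm (q + y) q = a" unfolding a by (simp add: herm_add_left herm_smult_left qq h)
    then have "a = 1" by (simp add: herm_add_left qq h)
    then show "x = y" using a by simp
  qed
qed

section \<open>Parallel sections along rays\<close>

text \<open>Picard iteration written as a series: \<open>d k\<close> is the \<open>k\<close>-th
  iterated integral, of size at most \<open>C ^ k / fact k\<close> times the norm of
  \<open>s0\<close>. The series converges uniformly and is differentiated term by term.\<close>

lemma linear_ode_exists:
  fixes A :: "real \<Rightarrow> ('e::banach \<Rightarrow>\<^sub>L 'e)"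
  assumes A: "continuous_on {0..1} A"
  obtains S where "S 0 = s0" "\<And>t. t \<in> {0..1} \<Longrightarrow> (S has_vector_derivative A t (S t)) (at t within {0..1})"
proof -
  define d where "d = rec_nat (\<lambda>t. s0) (\<lambda>_ f t. integral {0..t} (\<lambda>u. A u (f u)))"
  have d0: "d 0 t = s0" and dS: "d (Suc k) t = integral {0..t} (\<lambda>u. A u (d k u))" for k t
    by (simp_all add: d_def)
  \<comment> \<open>Term \<open>0\<close> is constant, so its derivative is \<open>0\<close>; the
    derivative of term \<open>Suc k\<close> is \<open>A\<close> applied to term \<open>k\<close>,
    one index lower.\<close>
  define d' where "d' k t = (case k of 0 \<Rightarrow> 0 | Suc k \<Rightarrow> A t (d k t))" for k t
  have cont_d: "continuous_on {0..1} (d k)"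
    and der_d: "t \<in> {0..1} \<Longrightarrow> (d k has_vector_derivative d' k t) (at t within {0..1})" for k t
  proof (induction k arbitrary: t)
    case 0
    case 1
    then show ?case using d0 by (simp add: continuous_on_eq[of _ "\<lambda>t. s0"])
    case 2
    have "d 0 = (\<lambda>t. s0)" using d0 by blast
    then show ?case by (simp add: d'_def)
  next
    case (Suc k)
    have c: "continuous_on {0..1} (\<lambda>u. A u (d k u))"
      by (intro blinfun.continuous_on A Suc)
    have *: "(d (Suc k) has_vector_derivative d' (Suc k) t) (at t within {0..1})" if "t \<in> {0..1}" for t
      using integral_has_vector_derivative[OF c that] dS[of k, abs_def] by (simp add: d'_def)
    case 1
    show ?case using * has_vector_derivative_continuous continuous_on_eq_continuous_within by blast
    case 2
    then show ?case by (rule *)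
  qed
  obtain C where C: "C \<ge> 0" "\<And>t. t \<in> {0..1} \<Longrightarrow> norm (A t) \<le> C"
  proof -
    have "bounded (A ` {0..1})" using A by (simp add: compact_continuous_image compact_imp_bounded)
    then obtain C where C: "\<And>t. t \<in> {0..1} \<Longrightarrow> norm (A t) \<le> C"
      by (auto simp: bounded_iff simp del: atLeastAtMost_iff)
    have "C \<ge> 0" using order_trans[OF norm_ge_zero C[of 0]] by simp
    with C that show thesis by blast
  qed
  have nd: "norm (d k t) \<le> norm s0 * (C * t) ^ k / fact k" if "t \<in> {0..1}" for k t
    using that
  proof (induction k arbitrary: t)
    case (Suc k)
    have "((\<lambda>u. norm s0 * (C ^ Suc k) / fact k * u ^ k) has_integral
        (norm s0 * C ^ Suc k / fact (Suc k)) * t ^ Suc k - (norm s0 * C ^ Suc k / fact (Suc k)) * 0 ^ Suc k) {0..t}"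
    proof (rule fundamental_theorem_of_calculus)
      fix x :: real
      have "((\<lambda>u. norm s0 * C ^ Suc k / fact (Suc k) * u ^ Suc k) has_real_derivative
          norm s0 * C ^ Suc k / fact (Suc k) * (real (Suc k) * x ^ k)) (at x within {0..t})"
        by (rule DERIV_cmult) (use DERIV_pow[of "Suc k" x "{0..t}"] in \<open>simp del: power_Suc of_nat_Suc\<close>)
      moreover have "norm s0 * C ^ Suc k / fact (Suc k) * (real (Suc k) * x ^ k) = norm s0 * C ^ Suc k / fact k * x ^ k"
        unfolding fact_Suc by (simp del: power_Suc of_nat_Suc)
      ultimately show "((\<lambda>u. norm s0 * C ^ Suc k / fact (Suc k) * u ^ Suc k) has_vector_derivative
          norm s0 * (C ^ Suc k) / fact k * x ^ k) (at x within {0..t})"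
        unfolding has_real_derivative_iff_has_vector_derivative by metis
    qed (use Suc.prems in auto)
    then have I: "((\<lambda>u. norm s0 * (C ^ Suc k) / fact k * u ^ k) has_integral
        norm s0 * (C * t) ^ Suc k / fact (Suc k)) {0..t}"
      by (simp add: power_mult_distrib mult.assoc mult.left_commute del: fact_Suc)
    have "continuous_on {0..t} (\<lambda>u. A u (d k u))"
      using Suc.prems by (intro blinfun.continuous_on continuous_on_subset[OF A] continuous_on_subset[OF cont_d]) auto
    then have ii: "(\<lambda>u. A u (d k u)) integrable_on {0..t}"
      by (rule integrable_continuous_real)
    have "norm (d (Suc k) t) \<le> integral {0..t} (\<lambda>u. norm s0 * (C ^ Suc k) / fact k * u ^ k)"
      unfolding dS
    proof (rule integral_norm_bound_integral[OF ii has_integral_integrable[OF I]])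
      fix u assume u: "u \<in> {0..t}"
      have "norm (A u (d k u)) \<le> norm (A u) * norm (d k u)" by (rule norm_blinfun)
      also have "\<dots> \<le> C * (norm s0 * (C * u) ^ k / fact k)"
        using u Suc.prems C by (intro mult_mono Suc.IH) auto
      finally show "norm (A u (d k u)) \<le> norm s0 * (C ^ Suc k) / fact k * u ^ k"
        by (simp add: power_mult_distrib mult_ac)
    qed
    also have "\<dots> = norm s0 * (C * t) ^ Suc k / fact (Suc k)"
      using I by (rule integral_unique)
    finally show ?case .
  qed (simp add: d0)
  define M where "M k = norm s0 * (C ^ k / fact k)" for k
  have summ_M: "summable M"
    unfolding M_def using summable_exp[of C] by (intro summable_mult) (simp add: field_simps)
  have ndM: "norm (d k t) \<le> M k" if "t \<in> {0..1}" for k t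
  proof -
    have "(C * t) ^ k \<le> C ^ k" using that C by (intro power_mono) (auto simp: mult_left_le)
    then have "norm s0 * (C * t) ^ k / fact k \<le> M k"
      unfolding M_def by (auto intro!: mult_left_mono divide_right_mono simp flip: times_divide_eq_right)
    then show ?thesis using nd[OF that, of k] by linarith
  qed
  define S where "S t = (\<Sum>k. d k t)" for t
  have ul: "uniform_limit {0..1} (\<lambda>n t. \<Sum>k<n. d k t) S sequentially"
    unfolding S_def by (rule Weierstrass_m_test[OF ndM summ_M])
  have sums: "(\<lambda>k. d k t) sums S t" if "t \<in> {0..1}" for t
    unfolding S_def by (rule summable_sums, rule summable_comparison_test'[OF summ_M, of 0]) (use ndM[OF that] in simp)
  have "\<exists>g. \<forall>t\<in>{0..1}. (\<lambda>k. d k t) sums g t \<and> (g has_derivative (\<lambda>h. h *\<^sub>R A t (S t))) (at t within {0..1})"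
  proof (rule has_derivative_series[where x=0 and l="S 0"])
    show "(d k has_derivative (\<lambda>h. h *\<^sub>R d' k t)) (at t within {0..1})" if "t \<in> {0..1}" for k t
      using der_d[OF that] by (simp add: has_vector_derivative_def)
    show "\<forall>\<^sub>F n in sequentially. \<forall>t\<in>{0..1}. \<forall>h. norm ((\<Sum>i<n. h *\<^sub>R d' i t) - h *\<^sub>R A t (S t)) \<le> e * norm h"
      if "e > 0" for e
    proof -
      have "\<forall>\<^sub>F n in sequentially. \<forall>t\<in>{0..1}. dist (\<Sum>k<n. d k t) (S t) < e / (C + 1)"
        using ul that C by (intro uniform_limitD) auto
      then have "\<forall>\<^sub>F n in sequentially. \<forall>t\<in>{0..1}. dist (\<Sum>k<n - 1. d k t) (S t) < e / (C + 1)"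
        by (subst (asm) eventually_sequentially_Suc[symmetric], subst eventually_sequentially_Suc[symmetric])
          (auto simp: eventually_sequentially intro: le_SucI Suc_leD)
      then show ?thesis using eventually_gt_at_top[of 0]
      proof eventually_elim
        case (elim n)
        show ?case
        proof (intro ballI allI)
          fix t h :: real assume t: "t \<in> {0..1}"
          obtain m where m: "n = Suc m" using elim(2) gr0_implies_Suc by blast
          \<comment> \<open>The first \<open>n\<close> derivatives sum to \<open>A\<close> of the
            first \<open>n - 1\<close> terms, which is why \<open>n = 0\<close> is excluded. The
            tolerance \<open>e / (C + 1)\<close> is chosen so that it stays meaningful for
            \<open>C = 0\<close>.\<close>
          have "(\<Sum>i<n. d' i t) = A t (\<Sum>k<m. d k t)"
            unfolding m by (subst sum.lessThan_Suc_shift) (simp add: d'_def blinfun.sum_right)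
          then have "norm ((\<Sum>i<n. h *\<^sub>R d' i t) - h *\<^sub>R A t (S t)) = norm (A t ((\<Sum>k<m. d k t) - S t)) * norm h"
            by (simp add: scaleR_sum_right[symmetric] scaleR_diff_right[symmetric] blinfun.diff_right)
          also have "norm (A t ((\<Sum>k<m. d k t) - S t)) \<le> norm (A t) * norm ((\<Sum>k<m. d k t) - S t)"
            by (rule norm_blinfun)
          also have "\<dots> \<le> C * (e / (C + 1))"
            using elim(1) t C m by (intro mult_mono) (auto simp: dist_norm less_imp_le)
          also have "\<dots> \<le> e" using C(1) that by (simp add: field_simps)
          finally show "norm ((\<Sum>i<n. h *\<^sub>R d' i t) - h *\<^sub>R A t (S t)) \<le> e * norm h"
            by (simp add: mult_right_mono)
        qed
      qed
    qed
  qed (use sums[of 0] in auto)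
  then obtain g where g: "\<And>t. t \<in> {0..1} \<Longrightarrow> (\<lambda>k. d k t) sums g t"
      "\<And>t. t \<in> {0..1} \<Longrightarrow> (g has_derivative (\<lambda>h. h *\<^sub>R A t (S t))) (at t within {0..1})"
    by blast
  have gS: "g t = S t" if "t \<in> {0..1}" for t using g(1) sums that sums_unique2 by blast
  show thesis
  proof
    have "(\<lambda>k. d k 0) sums s0"
    proof -
      have "d k 0 = (if k \<in> {0} then s0 else 0)" for k by (cases k) (auto simp: d0 dS)
      then show ?thesis using sums_If_finite_set[of "{0}" "\<lambda>k. s0"] by simp
    qed
    then show "g 0 = s0" using g(1)[of 0] sums_unique2 by fastforce
    show "(g has_vector_derivative A t (g t)) (at t within {0..1})" if "t \<in> {0..1}" for t
      using g(2)[OF that] gS[OF that] by (simp add: has_vector_derivative_def)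
  qed
qed

text \<open>An energy estimate: the squared norm is differentiable also where \<open>D\<close>
  vanishes, and adding \<open>e\<^sup>2\<close> absorbs the inhomogeneous term. The case
  \<open>e = 0\<close> gives uniqueness for linear equations.\<close>

lemma gronwall_vector:
  fixes D :: "real \<Rightarrow> 'e::real_inner"
  assumes D0: "D 0 = 0" and C: "0 \<le> C" and e: "0 \<le> e"
    and der: "\<And>t. t \<in> {0..1} \<Longrightarrow> (D has_vector_derivative D' t) (at t within {0..1})"
    and bound: "\<And>t. t \<in> {0..1} \<Longrightarrow> norm (D' t) \<le> C * norm (D t) + e"
    and t: "t \<in> {0..1}"
  shows "norm (D t) \<le> e * exp (C + 1)"
proof -
  \<comment> \<open>The estimate of twice \<open>norm (D u) * e\<close> by the sum of the two
    squares costs the extra \<open>1\<close> in \<open>k\<close>. On \<open>{0..1}\<close> the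
    factor \<open>exp (k * t)\<close> is at most the square of \<open>exp (C + 1)\<close>.\<close>
  define k where "k = 2 * C + 1"
  define f where "f u = (D u \<bullet> D u + e\<^sup>2) * exp (- k * u)" for u
  have "f t \<le> f 0"
  proof (rule DERIV_nonpos_imp_decreasing_open[of 0 t f])
    show "0 \<le> t" using t by simp
    have cD: "continuous_on {0..1} D"
      using der has_vector_derivative_continuous continuous_on_eq_continuous_within by blast
    show "continuous_on {0..t} f"
      unfolding f_def using t by (intro continuous_intros continuous_on_subset[OF cD]) auto
    fix u assume u: "0 < u" "u < t"
    have "(D has_vector_derivative D' u) (at u)"
      using der[of u] u t at_within_Icc_at[of 0 u 1] by auto
    then have dD: "(D has_derivative (\<lambda>h. h *\<^sub>R D' u)) (at u)"
      by (simp add: has_vector_derivative_def)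
    have "((\<lambda>u. D u \<bullet> D u) has_derivative (\<lambda>h. D u \<bullet> (h *\<^sub>R D' u) + (h *\<^sub>R D' u) \<bullet> D u)) (at u)"
      by (rule has_derivative_inner[OF dD dD])
    then have dn: "((\<lambda>u. D u \<bullet> D u) has_real_derivative 2 * (D u \<bullet> D' u)) (at u)"
      by (simp add: has_field_derivative_def inner_commute mult_commute_abs algebra_simps)
    have df: "(f has_real_derivative (2 * (D u \<bullet> D' u) - k * (D u \<bullet> D u + e\<^sup>2)) * exp (- k * u)) (at u)"
      unfolding f_def by (rule derivative_eq_intros dn refl | simp add: algebra_simps)+
    have "D u \<bullet> D' u \<le> norm (D u) * norm (D' u)" by (rule norm_cauchy_schwarz)
    also have "\<dots> \<le> norm (D u) * (C * norm (D u) + e)"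
      using bound[of u] u t by (intro mult_left_mono) auto
    finally have "2 * (D u \<bullet> D' u) \<le> 2 * C * (norm (D u))\<^sup>2 + 2 * (norm (D u) * e)"
      by (simp add: algebra_simps power2_eq_square)
    also have "2 * (norm (D u) * e) \<le> (norm (D u))\<^sup>2 + e\<^sup>2"
      using sum_squares_bound[of "norm (D u)" e] by simp
    finally have "2 * (D u \<bullet> D' u) - k * (D u \<bullet> D u + e\<^sup>2) \<le> - (2 * C * e\<^sup>2)"
      by (simp add: k_def dot_square_norm algebra_simps)
    also have "\<dots> \<le> 0" using C by simp
    finally show "\<exists>y. (f has_real_derivative y) (at u) \<and> y \<le> 0"
      using df by (meson exp_ge_zero mult_nonpos_nonneg)
  qed
  then have "(D t \<bullet> D t + e\<^sup>2) * exp (- k * t) \<le> e\<^sup>2" by (simp add: f_def D0)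
  then have "D t \<bullet> D t + e\<^sup>2 \<le> e\<^sup>2 * exp (k * t)"
    by (simp add: exp_minus field_simps)
  also have "\<dots> \<le> e\<^sup>2 * exp (2 * (C + 1))"
    using t C by (intro mult_left_mono) (auto simp: k_def intro: order_trans[OF mult_left_le])
  also have "\<dots> = (e * exp (C + 1))\<^sup>2" by (subst exp_double) (rule power_mult_distrib[symmetric])
  finally have "(norm (D t))\<^sup>2 \<le> (e * exp (C + 1))\<^sup>2"
    by (simp add: dot_square_norm) (smt (verit) zero_le_power2)
  then show ?thesis using e by (auto intro: power2_le_imp_le)
qed

text \<open>
  Let \<open>S x t\<close> be the parallel transport of \<open>s0\<close> along the ray from \<open>0\<close> to \<open>x\<close>. To differentiate
  \<open>S x 1\<close> in \<open>x\<close>, the section \<open>S y t\<close> is compared with \<open>Q (t y) (S x t)\<close>, which satisfies the equation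
  of \<open>S y\<close> up to \<open>t [Q' x, Q' h] (S x t) + o(h)\<close> with \<open>h = y - x\<close>. The bracket vanishes by flatness,
  and no second derivative of \<open>Q\<close> is needed.
\<close>

lemma parallel_section_convex:
  fixes N :: "'a::euclidean_space set" and Q :: "'a \<Rightarrow> ('e::euclidean_space \<Rightarrow>\<^sub>L 'e)"
    and Q' :: "'a \<Rightarrow> ('a \<Rightarrow>\<^sub>L ('e \<Rightarrow>\<^sub>L 'e))"
  assumes N: "open N" "convex N" "0 \<in> N"
    and der: "\<And>x. x \<in> N \<Longrightarrow> (Q has_derivative Q' x) (at x)"
    and cont: "continuous_on N Q'"
    and idem: "\<And>x v. x \<in> N \<Longrightarrow> Q x (Q x v) = Q x v"
    and selfadj: "\<And>x v w. x \<in> N \<Longrightarrow> Q x v \<bullet> w = v \<bullet> Q x w"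
    and flat: "\<And>x v X Y. x \<in> N \<Longrightarrow> norm v = 1 \<Longrightarrow> Q x v = v \<Longrightarrow> Q' x X (Q' x Y v) = Q' x Y (Q' x X v)"
    and s0: "Q 0 s0 = s0" "norm s0 = 1"
  obtains s where "\<And>x. x \<in> N \<Longrightarrow> Q x (s x) = s x" "\<And>x. x \<in> N \<Longrightarrow> norm (s x) = 1"
    "\<And>x. x \<in> N \<Longrightarrow> (s has_derivative (\<lambda>X. Q' x X (s x))) (at x)"
proof -
  \<comment> \<open>Derivative of the relation \<open>Q Q = Q\<close>. It implies that
    \<open>Q' x X\<close> maps the image of \<open>Q x\<close> into its kernel.\<close>
  have leibniz: "Q' x X v = Q' x X (Q x v) + Q x (Q' x X v)" if "x \<in> N" for x X v
  proof -
    have d1: "((\<lambda>y. Q y v) has_derivative (\<lambda>X. Q' x X v)) (at x)"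
      using bounded_linear.has_derivative[OF bounded_bilinear.bounded_linear_left[OF bounded_bilinear_blinfun_apply] der[OF that]] .
    have "((\<lambda>y. Q y (Q y v)) has_derivative (\<lambda>X. Q x (Q' x X v) + Q' x X (Q x v))) (at x)"
      by (rule bounded_bilinear.FDERIV[OF bounded_bilinear_blinfun_apply der[OF that] d1])
    then have "((\<lambda>y. Q y v) has_derivative (\<lambda>X. Q x (Q' x X v) + Q' x X (Q x v))) (at x)"
      by (rule has_derivative_transform_within_open[OF _ N(1) that]) (rule idem)
    with d1 have "(\<lambda>X. Q' x X v) = (\<lambda>X. Q x (Q' x X v) + Q' x X (Q x v))"
      by (rule has_derivative_unique)
    then show ?thesis by (metis add.commute)
  qed
  have seg: "t *\<^sub>R x \<in> N" if "x \<in> N" "t \<in> {0..1}" for x t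
    using convexD_alt[OF N(2) N(3) that(1), of t] that(2) by simp
  have ctx: "continuous_on {0..1} (\<lambda>t. Q' (t *\<^sub>R x) x)" if "x \<in> N" for x
    by (intro blinfun.continuous_on continuous_on_compose2[OF cont] continuous_intros) (use seg that in auto)
  have "\<exists>S. S 0 = s0 \<and> (\<forall>t\<in>{0..1}. (S has_vector_derivative Q' (t *\<^sub>R x) x (S t)) (at t within {0..1}))"
    if "x \<in> N" for x
    by (rule linear_ode_exists[OF ctx[OF that], of s0]) blast
  then obtain S where S0: "\<And>x. x \<in> N \<Longrightarrow> S x 0 = s0"
    and dS: "\<And>x t. x \<in> N \<Longrightarrow> t \<in> {0..1} \<Longrightarrow> (S x has_vector_derivative Q' (t *\<^sub>R x) x (S x t)) (at t within {0..1})"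
    by metis
  have dQray: "((\<lambda>t. Q (t *\<^sub>R y) (f t)) has_vector_derivative Q' (t *\<^sub>R y) y (f t) + Q (t *\<^sub>R y) f') (at t within {0..1})"
    if "y \<in> N" "t \<in> {0..1}" "(f has_vector_derivative f') (at t within {0..1})" for y t f f'
  proof -
    have "((\<lambda>t. Q (t *\<^sub>R y)) has_derivative (\<lambda>h. Q' (t *\<^sub>R y) (h *\<^sub>R y))) (at t within {0..1})"
      by (rule has_derivative_compose[where g=Q and f="\<lambda>t. t *\<^sub>R y", OF _ der[OF seg[OF that(1,2)]]])
        (auto intro!: derivative_eq_intros)
    from bounded_bilinear.FDERIV[OF bounded_bilinear_blinfun_apply this that(3)[unfolded has_vector_derivative_def]]
    show ?thesis
      unfolding has_vector_derivative_def
      by (rule has_derivative_eq_rhs) (simp add: fun_eq_iff blinfun.scaleR_left blinfun.scaleR_right scaleR_right_distrib)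
  qed
  \<comment> \<open>The defect \<open>D = S - Q S\<close> solves \<open>D' = - Q' D\<close> with
    \<open>D 0 = 0\<close>, so it vanishes by the case \<open>e = 0\<close> of
    \<open>gronwall_vector\<close>.\<close>
  have QS: "Q (t *\<^sub>R x) (S x t) = S x t" if x: "x \<in> N" and t: "t \<in> {0..1}" for x t
  proof -
    obtain C where C: "\<And>t. t \<in> {0..1} \<Longrightarrow> norm (Q' (t *\<^sub>R x) x) \<le> C"
      using compact_imp_bounded[OF compact_continuous_image[OF ctx[OF x] compact_Icc]]
      by (auto simp: bounded_iff simp del: atLeastAtMost_iff)
    have C0: "C \<ge> 0" using order_trans[OF norm_ge_zero C[of 0]] by simp
    define D where "D t = S x t - Q (t *\<^sub>R x) (S x t)" for t
    have "norm (D t) \<le> 0 * exp (C + 1)"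
    proof (rule gronwall_vector[OF _ C0 _ _ _ t])
      show "D 0 = 0" by (simp add: D_def S0 x s0)
      fix u :: real assume u: "u \<in> {0..1}"
      have "(D has_vector_derivative Q' (u *\<^sub>R x) x (S x u) - (Q' (u *\<^sub>R x) x (S x u) + Q (u *\<^sub>R x) (Q' (u *\<^sub>R x) x (S x u)))) (at u within {0..1})"
        unfolding D_def by (intro has_vector_derivative_diff dS[OF x u] dQray[OF x u])
      moreover have "Q' (u *\<^sub>R x) x (S x u) - (Q' (u *\<^sub>R x) x (S x u) + Q (u *\<^sub>R x) (Q' (u *\<^sub>R x) x (S x u))) = - (Q' (u *\<^sub>R x) x (D u))"
        using leibniz[OF seg[OF x u], of x "S x u"] by (simp add: D_def blinfun.diff_right) (metis add_diff_cancel_left' minus_diff_eq)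
      ultimately show "(D has_vector_derivative - (Q' (u *\<^sub>R x) x (D u))) (at u within {0..1})" by simp
      have "norm (Q' (u *\<^sub>R x) x (D u)) \<le> norm (Q' (u *\<^sub>R x) x) * norm (D u)" by (rule norm_blinfun)
      also have "\<dots> \<le> C * norm (D u)" by (intro mult_right_mono C u) simp
      finally show "norm (- (Q' (u *\<^sub>R x) x (D u))) \<le> C * norm (D u) + 0" by simp
    qed simp
    then show ?thesis by (simp add: D_def)
  qed
  have QQ': "Q x (Q' x X v) = 0" if "x \<in> N" "Q x v = v" for x v X
    using leibniz[OF that(1), of X v] that(2) by simp
  \<comment> \<open>\<open>S\<close> lies in the image of the self-adjoint idempotent
    \<open>Q\<close> and its derivative in the kernel, so the two are orthogonal and the norm is
    constant.\<close>
  have nS: "norm (S x t) = 1" if x: "x \<in> N" and t: "t \<in> {0..1}" for x t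
  proof -
    have "((\<lambda>t. S x t \<bullet> S x t) has_derivative (\<lambda>h. 0)) (at u within {0..1})" if u: "u \<in> {0..1}" for u
    proof -
      have dS': "(S x has_derivative (\<lambda>h. h *\<^sub>R Q' (u *\<^sub>R x) x (S x u))) (at u within {0..1})"
        using dS[OF x u] by (simp add: has_vector_derivative_def)
      have "S x u \<bullet> Q' (u *\<^sub>R x) x (S x u) = S x u \<bullet> Q (u *\<^sub>R x) (Q' (u *\<^sub>R x) x (S x u))"
        using selfadj[OF seg[OF x u], of "S x u"] QS[OF x u] by metis
      also have "\<dots> = 0" using QQ'[OF seg[OF x u] QS[OF x u]] by simp
      finally show ?thesis
        using has_derivative_inner[OF dS' dS'] by (simp add: inner_commute)
    qed
    then obtain c where "\<And>t. t \<in> {0..1} \<Longrightarrow> S x t \<bullet> S x t = c"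
      using has_derivative_zero_constant[OF convex_closed_interval(1)[of 0 "1::real"]] by (metis convex_real_interval(5))
    then have "S x t \<bullet> S x t = S x 0 \<bullet> S x 0" using t by simp
    then show ?thesis using S0[OF x] s0(2) by (simp add: norm_eq_sqrt_inner)
  qed
  show thesis
  proof
    show "Q x (S x 1) = S x 1" if "x \<in> N" for x using QS[OF that, of 1] by simp
    show "norm (S x 1) = 1" if "x \<in> N" for x using nS[OF that, of 1] by simp
    fix x assume x: "x \<in> N"
    obtain r where r: "r > 0" "cball x r \<subseteq> N" using N(1) x open_contains_cball by blast
    \<comment> \<open>A compact part of \<open>N\<close> that contains the rays from
      \<open>0\<close> to all points near \<open>x\<close>; on it \<open>Q'\<close> is bounded and
      uniformly continuous.\<close>
    define K where "K = convex hull (insert 0 (cball x r))"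
    have K: "compact K" "convex K" "K \<subseteq> N"
      unfolding K_def using r N hull_minimal[of "insert 0 (cball x r)" N convex]
      by (auto intro!: compact_convex_hull simp: compact_insert)
    have segK: "t *\<^sub>R y \<in> K" if "y \<in> cball x r" "t \<in> {0..1}" for y t
      using convexD_alt[OF K(2), of 0 y t] that hull_subset[of "insert 0 (cball x r)" convex] by (auto simp: K_def)
    have contK: "continuous_on K Q'" using cont K(3) continuous_on_subset by blast
    obtain C where C: "\<And>z. z \<in> K \<Longrightarrow> norm (Q' z) \<le> C"
      using compact_imp_bounded[OF compact_continuous_image[OF contK K(1)]] by (auto simp: bounded_iff)
    have C0: "C \<ge> 0" using order_trans[OF norm_ge_zero C[of 0]] segK[of x 0] r by auto
    define R where "R = norm x + r"
    have R0: "R \<ge> 0" and xR: "norm x \<le> R" using r by (auto simp: R_def)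
    \<comment> \<open>The \<open>1\<close> accounts for the remainder \<open>\<rho> 1\<close>; the
      other summand is the Gronwall bound for \<open>D 1\<close>, with rate \<open>C * R\<close> and
      defect factor \<open>C * (3 * R + C)\<close>.\<close>
    define L where "L = 1 + C * (3 * R + C) * exp (C * R + 1)"
    have L0: "L > 0" using C0 R0 by (auto simp: L_def intro!: add_pos_nonneg mult_nonneg_nonneg)
    have blQ': "norm (Q' z X v) \<le> C * norm X * norm v" if "z \<in> K" for z X v
    proof -
      have "norm (Q' z X v) \<le> norm (Q' z X) * norm v" by (rule norm_blinfun)
      also have "norm (Q' z X) \<le> norm (Q' z) * norm X" by (rule norm_blinfun)
      also have "\<dots> \<le> C * norm X" by (intro mult_right_mono C that) simp
      finally show ?thesis by (simp add: mult_right_mono)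
    qed
    have main: "\<exists>d>0. \<forall>y. norm (y - x) < d \<longrightarrow>
        norm (S y 1 - S x 1 - Q' x (y - x) (S x 1)) \<le> L * e * norm (y - x)" if e: "e > 0" for e
    proof -
      obtain d where d: "d > 0" "\<And>z w. z \<in> K \<Longrightarrow> w \<in> K \<Longrightarrow> dist w z < d \<Longrightarrow> dist (Q' w) (Q' z) < e"
        using compact_uniformly_continuous[OF contK K(1)] e unfolding uniformly_continuous_on_def by metis
      show ?thesis
      \<comment> \<open>\<open>d\<close> controls the oscillation of \<open>Q'\<close>,
        \<open>r\<close> keeps \<open>y\<close> in the ball, and \<open>e\<close> gives
        \<open>norm h \<le> e\<close>, which makes \<open>Q' (t *\<^sub>R x) h\<close> of size at
        most \<open>C * e\<close>.\<close>
      proof (intro exI[of _ "min d (min r e)"] conjI allI impI)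
        show "0 < min d (min r e)" using d r e by simp
        fix y assume y: "norm (y - x) < min d (min r e)"
        define h where "h = y - x"
        have yh: "y = x + h" and hd: "norm h < d" "norm h \<le> e" using y by (auto simp: h_def)
        have ycb: "y \<in> cball x r" using y by (simp add: dist_norm norm_minus_commute)
        have xcb: "x \<in> cball x r" using r by simp
        have yN: "y \<in> N" using ycb r by blast
        have yR: "norm y \<le> R"
          using norm_triangle_ineq[of x h] y by (simp add: R_def yh)
        \<comment> \<open>First-order Taylor remainder of \<open>Q\<close> at
          \<open>t *\<^sub>R x\<close>, bounded below by means of the mean value inequality on a
          segment inside \<open>K\<close>.\<close>
        define \<rho> where "\<rho> t = Q (t *\<^sub>R y) - Q (t *\<^sub>R x) - t *\<^sub>R Q' (t *\<^sub>R x) h" for t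
        have close: "norm (Q' z - Q' (t *\<^sub>R x)) \<le> e" if "t \<in> {0..1}" "z \<in> K" "dist z (t *\<^sub>R x) \<le> norm h" for t z
          using d(2)[OF segK[OF xcb that(1)] that(2)] that(3) hd by (simp add: dist_norm less_imp_le)
        have \<rho>: "norm (\<rho> t) \<le> e * norm h" if t: "t \<in> {0..1}" for t
        proof -
          let ?T = "closed_segment (t *\<^sub>R x) (t *\<^sub>R y)"
          have TK: "?T \<subseteq> K" using segK[OF xcb t] segK[OF ycb t] K(2) by (simp add: closed_segment_subset)
          have "norm (Q (t *\<^sub>R y) - Q (t *\<^sub>R x) - Q' (t *\<^sub>R x) (t *\<^sub>R y - t *\<^sub>R x)) \<le> norm (t *\<^sub>R y - t *\<^sub>R x) * e"
          proof (rule differentiable_bound_linearization[where S="?T"])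
            show "t *\<^sub>R x + u *\<^sub>R (t *\<^sub>R y - t *\<^sub>R x) \<in> ?T" if "u \<in> {0..1}" for u
              using that by (auto simp: closed_segment_def algebra_simps intro!: exI[of _ u])
            show "(Q has_derivative Q' z) (at z within ?T)" if "z \<in> ?T" for z
              using der[of z] that TK K(3) has_derivative_at_withinI by blast
            show "onorm (blinfun_apply (Q' z) - blinfun_apply (Q' (t *\<^sub>R x))) \<le> e" if "z \<in> ?T" for z
            proof -
              have "dist z (t *\<^sub>R x) \<le> dist (t *\<^sub>R y) (t *\<^sub>R x)"
                using segment_bound(1)[OF that] by (simp add: dist_norm)
              also have "\<dots> \<le> norm h"
                using t by (simp add: dist_norm scaleR_diff_right[symmetric] h_def[symmetric] mult_left_le_one_le)
              finally have "norm (Q' z - Q' (t *\<^sub>R x)) \<le> e" using close[OF t _] that TK by blast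
              then show ?thesis by (simp add: norm_blinfun.rep_eq minus_blinfun.rep_eq fun_diff_def)
            qed
          qed simp
          moreover have "t *\<^sub>R y - t *\<^sub>R x = t *\<^sub>R h" by (simp add: h_def scaleR_diff_right)
          ultimately have "norm (\<rho> t) \<le> \<bar>t\<bar> * norm h * e" by (simp add: \<rho>_def blinfun.scaleR_right)
          also have "\<dots> \<le> e * norm h" using t e by (simp add: mult_left_le_one_le mult.commute mult_left_mono)
          finally show ?thesis .
        qed
        define D where "D t = Q (t *\<^sub>R y) (S x t) - S y t" for t
        define E where "E t = Q' (t *\<^sub>R y) y (S x t - Q (t *\<^sub>R y) (S x t)) + Q (t *\<^sub>R y) (Q' (t *\<^sub>R x) x (S x t))" for t
        have E: "norm (E t) \<le> e * norm h * (C * (3 * R + C))" if t: "t \<in> {0..1}" for t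
        proof -
          let ?\<sigma> = "S x t" and ?a = "Q' (t *\<^sub>R x)" and ?b = "Q' (t *\<^sub>R y)"
          have QB: "Q (t *\<^sub>R y) v = Q (t *\<^sub>R x) v + t *\<^sub>R ?a h v + \<rho> t v" for v
            by (simp add: \<rho>_def blinfun.diff_left blinfun.add_left blinfun.scaleR_left)
          have Q\<sigma>: "Q (t *\<^sub>R x) ?\<sigma> = ?\<sigma>" by (rule QS[OF x t])
          have n\<sigma>: "norm ?\<sigma> = 1" by (rule nS[OF x t])
          have Qa: "Q (t *\<^sub>R x) (?a x ?\<sigma>) = 0" by (rule QQ'[OF seg[OF x t] Q\<sigma>])
          have fl: "?a h (?a x ?\<sigma>) = ?a x (?a h ?\<sigma>)" by (rule flat[OF seg[OF x t] n\<sigma> Q\<sigma>])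
          \<comment> \<open>Flatness acts here: the terms of first order in \<open>h\<close>, namely
            \<open>t *\<^sub>R ?a h (?a x ?\<sigma>)\<close> and
            \<open>t *\<^sub>R ?b y (?a h ?\<sigma>)\<close>, combine into one with the small factor
            \<open>?b y - ?a x\<close>.\<close>
          have Eeq: "E t = \<rho> t (?a x ?\<sigma>) - ?b y (\<rho> t ?\<sigma>) - t *\<^sub>R ((?b y - ?a x) (?a h ?\<sigma>))"
            unfolding E_def QB Q\<sigma> Qa
            by (simp add: blinfun.diff_left blinfun.diff_right blinfun.add_right blinfun.minus_right blinfun.scaleR_right
                fl scaleR_diff_right)
          have bax: "norm (?b y - ?a x) \<le> e * (R + C)"
          proof -
            have "dist (t *\<^sub>R y) (t *\<^sub>R x) \<le> norm h"
              using t by (simp add: dist_norm scaleR_diff_right[symmetric] h_def[symmetric] mult_left_le_one_le)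
            then have "norm (?b - ?a) \<le> e" by (rule close[OF t segK[OF ycb t]])
            then have 1: "norm ((?b - ?a) y) \<le> e * R"
              using norm_blinfun[of "?b - ?a" y] yR e by (meson mult_mono norm_ge_zero order_trans less_imp_le)
            have "norm (?a h) \<le> norm ?a * norm h" by (rule norm_blinfun)
            also have "\<dots> \<le> C * e" using C[OF segK[OF xcb t]] hd C0 by (intro mult_mono) auto
            finally have 2: "norm (?a h) \<le> C * e" .
            have "?b y - ?a x = (?b - ?a) y + ?a h"
              by (simp add: yh blinfun.diff_left blinfun.add_right)
            then have "norm (?b y - ?a x) \<le> norm ((?b - ?a) y) + norm (?a h)"
              using norm_triangle_ineq by metis
            with 1 2 show ?thesis by (simp add: algebra_simps)
          qed
          have ax: "norm (?a x ?\<sigma>) \<le> C * R"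
            using blQ'[OF segK[OF xcb t], of x ?\<sigma>] n\<sigma> mult_left_mono[OF xR C0] by simp
          have ah: "norm (?a h ?\<sigma>) \<le> C * norm h"
            using blQ'[OF segK[OF xcb t], of h ?\<sigma>] n\<sigma> by simp
          have 1: "norm (\<rho> t (?a x ?\<sigma>)) \<le> e * norm h * (C * R)"
            using norm_blinfun[of "\<rho> t" "?a x ?\<sigma>"] mult_mono[OF \<rho>[OF t] ax] e by (meson mult_nonneg_nonneg norm_ge_zero order_trans less_imp_le)
          have "norm (?b y (\<rho> t ?\<sigma>)) \<le> C * norm y * norm (\<rho> t ?\<sigma>)" by (rule blQ'[OF segK[OF ycb t]])
          also have "\<dots> \<le> C * R * (e * norm h)"
          proof (intro mult_mono order_refl yR)
            show "norm (\<rho> t ?\<sigma>) \<le> e * norm h" using norm_blinfun[of "\<rho> t" ?\<sigma>] \<rho>[OF t] n\<sigma> by simp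
          qed (use C0 R0 in auto)
          finally have 2: "norm (?b y (\<rho> t ?\<sigma>)) \<le> e * norm h * (C * R)" by (simp add: mult_ac)
          have "norm (t *\<^sub>R ((?b y - ?a x) (?a h ?\<sigma>))) \<le> norm ((?b y - ?a x) (?a h ?\<sigma>))"
            using t by (simp add: mult_left_le_one_le)
          also have "\<dots> \<le> norm (?b y - ?a x) * norm (?a h ?\<sigma>)" by (rule norm_blinfun)
          also have "\<dots> \<le> e * (R + C) * (C * norm h)" using e R0 C0 by (intro mult_mono bax ah) auto
          finally have 3: "norm (t *\<^sub>R ((?b y - ?a x) (?a h ?\<sigma>))) \<le> e * norm h * (C * (R + C))" by (simp add: mult_ac)
          have "norm (E t) \<le> norm (\<rho> t (?a x ?\<sigma>)) + norm (?b y (\<rho> t ?\<sigma>)) + norm (t *\<^sub>R ((?b y - ?a x) (?a h ?\<sigma>)))"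
            unfolding Eeq by (meson norm_triangle_ineq4 add_right_mono order_trans)
          then show ?thesis using 1 2 3 by (simp add: algebra_simps)
        qed
        have D1: "norm (D 1) \<le> (e * norm h * (C * (3 * R + C))) * exp (C * R + 1)"
        proof (rule gronwall_vector)
          show "D 0 = 0" by (simp add: D_def S0 x yN s0)
          show "0 \<le> C * R" "0 \<le> e * norm h * (C * (3 * R + C))" using C0 R0 e by auto
          fix t :: real assume t: "t \<in> {0..1}"
          have "(D has_vector_derivative (Q' (t *\<^sub>R y) y (S x t) + Q (t *\<^sub>R y) (Q' (t *\<^sub>R x) x (S x t)))
              - Q' (t *\<^sub>R y) y (S y t)) (at t within {0..1})"
            unfolding D_def by (intro has_vector_derivative_diff dS[OF yN t] dQray[OF yN t] dS[OF x t])
          moreover have "(Q' (t *\<^sub>R y) y (S x t) + Q (t *\<^sub>R y) (Q' (t *\<^sub>R x) x (S x t))) - Q' (t *\<^sub>R y) y (S y t)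
              = Q' (t *\<^sub>R y) y (D t) + E t"
            by (simp add: D_def E_def blinfun.diff_right)
          ultimately show "(D has_vector_derivative Q' (t *\<^sub>R y) y (D t) + E t) (at t within {0..1})" by simp
          have "norm (Q' (t *\<^sub>R y) y (D t)) \<le> C * norm y * norm (D t)" by (rule blQ'[OF segK[OF ycb t]])
          also have "\<dots> \<le> C * R * norm (D t)" using C0 yR by (intro mult_right_mono mult_left_mono) auto
          finally show "norm (Q' (t *\<^sub>R y) y (D t) + E t) \<le> C * R * norm (D t) + e * norm h * (C * (3 * R + C))"
            using norm_triangle_ineq[of "Q' (t *\<^sub>R y) y (D t)" "E t"] E[OF t] by linarith
        qed simp
        have "S y 1 - S x 1 - Q' x h (S x 1) = \<rho> 1 (S x 1) - D 1"
          using QS[OF x, of 1] by (simp add: \<rho>_def D_def blinfun.diff_left)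
        then have "norm (S y 1 - S x 1 - Q' x h (S x 1)) \<le> norm (\<rho> 1 (S x 1)) + norm (D 1)"
          by (simp add: norm_triangle_ineq4)
        also have "norm (\<rho> 1 (S x 1)) \<le> e * norm h"
          using norm_blinfun[of "\<rho> 1" "S x 1"] \<rho>[of 1] nS[OF x, of 1] by simp
        finally show "norm (S y 1 - S x 1 - Q' x (y - x) (S x 1)) \<le> L * e * norm (y - x)"
          using D1 by (simp add: L_def h_def[symmetric] algebra_simps)
      qed
    qed
    show "((\<lambda>x. S x 1) has_derivative (\<lambda>X. Q' x X (S x 1))) (at x)"
      unfolding has_derivative_at_alt
    proof (intro conjI allI impI)
      show "bounded_linear (\<lambda>X. Q' x X (S x 1))"
        by (rule bounded_linear_compose[OF bounded_bilinear.bounded_linear_left[OF bounded_bilinear_blinfun_apply] blinfun.bounded_linear_right])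
      fix e :: real assume "e > 0"
      then have "e / L > 0" using L0 by simp
      from main[OF this] show "\<exists>d>0. \<forall>y. norm (y - x) < d \<longrightarrow>
          norm (S y 1 - S x 1 - Q' x (y - x) (S x 1)) \<le> e * norm (y - x)"
        using L0 by simp
    qed
  qed
qed

section \<open>The horizontal lift\<close>

text \<open>Built from the set \<open>f x\<close> alone, so that no choice of a spanning vector
  enters, and packaged as an operator, so that its derivative lives in a normed space.\<close>

definition line_proj :: "(complex \<Rightarrow> (complex ^ ('m::finite \<times> 2)) set) \<Rightarrow> complex \<Rightarrow>
    ((complex ^ ('m \<times> 2)) \<Rightarrow>\<^sub>L (complex ^ ('m \<times> 2)))" where
  "line_proj f x = Blinfun (closest_point (f x))"

lemma line_proj_apply:
  assumes "f x = hline n" "n \<noteq> 0"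
  shows "line_proj f x v = (1 / (n \<bullet> n)) *\<^sub>R hp_part n v"
proof -
  have "closest_point (f x) = (\<lambda>v. (1 / (n \<bullet> n)) *\<^sub>R hp_part n v)"
    using closest_point_hline[OF assms(2)] assms(1) by auto
  moreover have "bounded_linear (\<lambda>v. (1 / (n \<bullet> n)) *\<^sub>R hp_part n v)"
    using hp.linear_T[of n] by (simp add: linear_conv_bounded_linear[symmetric] linear_compose_scale_right)
  ultimately show ?thesis by (simp add: line_proj_def bounded_linear_Blinfun_apply)
qed

lemma line_proj_mem:
  assumes "f x = hline n" "n \<noteq> 0"
  shows "line_proj f x v \<in> f x"
proof -
  have "closest_point (f x) v = line_proj f x v"
    unfolding line_proj_apply[of f, OF assms] assms(1) by (rule closest_point_hline[OF assms(2)])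
  moreover have "closest_point (f x) v \<in> f x"
    unfolding assms(1) by (rule closest_point_in_set[OF closed_subspace[OF subspace_hline]]) (use hline_self in auto)
  ultimately show ?thesis by simp
qed

lemma line_proj_idem:
  assumes "f x = hline n" "n \<noteq> 0"
  shows "line_proj f x (line_proj f x v) = line_proj f x v"
  unfolding line_proj_apply[of f, OF assms] using assms(2)
  by (simp add: linear_cmul[OF hp.linear_T] hp.T_T)

lemma line_proj_self_adjoint:
  assumes "f x = hline n" "n \<noteq> 0"
  shows "line_proj f x v \<bullet> w = v \<bullet> line_proj f x w"
  unfolding line_proj_apply[of f, OF assms] by (simp add: hp.T_adj)

lemma line_proj_fixed:
  assumes "f x = hline n" "n \<noteq> 0" "v \<noteq> 0" "line_proj f x v = v"
  shows "hline v = f x"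
  using hline_eq[of v n] line_proj_mem[of f, OF assms(1,2), of v] assms by simp

lemma chart_point_nz:
  assumes "norm q = 1" "w \<in> hp_hor q" shows "q + w \<noteq> 0"
proof
  assume "q + w = 0"
  then have "w = - q" by (simp add: eq_neg_iff_add_eq_0 add.commute)
  then have "q \<bullet> q = 0" using hp.H_orth[OF assms(2)] by simp
  then show False using assms(1) by simp
qed

lemma smooth_map_unit:
  assumes "smooth_map hline hp_hor M \<phi>" "x \<in> M"
  obtains q where "norm q = 1" "\<phi> x = hline q" "q \<noteq> 0"
proof -
  have "\<phi> x \<in> hline ` sphere 0 1" using assms unfolding smooth_map_def by blast
  then obtain q where "norm q = 1" "\<phi> x = hline q" by auto
  moreover have "q \<noteq> 0" using \<open>norm q = 1\<close> by auto
  ultimately show thesis using that by blast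
qed

text \<open>In a chart the line is spanned by \<open>q + w x\<close>, and the projection is a
  rational expression in this vector. Independence of the spanning vector makes these local formulas
  sufficient.\<close>

lemma smooth_line_proj:
  assumes sm: "smooth_map hline hp_hor M \<phi>"
  shows "smooth_on M (line_proj \<phi>)"
proof (rule smooth_on_locally)
  fix p assume p: "p \<in> M"
  obtain q where q: "norm q = 1" "\<phi> p = hline q" using smooth_map_unit[OF sm p] .
  obtain U w where U: "open U" "p \<in> U" "U \<subseteq> M" "smooth_on U w" "\<And>x. x \<in> U \<Longrightarrow> w x \<in> hp_hor q"
    "\<And>x. x \<in> U \<Longrightarrow> \<phi> x = hline (q + w x)"
    using hp.chart_at[OF sm p q(1) q(2)[symmetric]] by metis
  define n where "n x = q + w x" for x
  have sn: "smooth_on U n" unfolding n_def by (intro smooth_on_add smooth_on_const U)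
  have sj: "smooth_on U (\<lambda>x. jmul (n x))" by (rule smooth_on_bounded_linear[OF U(1) bounded_linear_jmul sn])
  have n0: "n x \<noteq> 0" if "x \<in> U" for x unfolding n_def using chart_point_nz[OF q(1) U(5)[OF that]] .
  have "smooth_on U (line_proj \<phi>)"
  proof (rule smooth_on_blinfunI[OF U(1)])
    fix v
    have "smooth_on U (\<lambda>x. inverse (n x \<bullet> n x) *\<^sub>R (herm v (n x) *s n x + herm v (jmul (n x)) *s jmul (n x)))"
      by (intro smooth_on_bilinear[OF U(1) bounded_bilinear_scaleR] smooth_on_inverse[OF U(1)] smooth_on_add[OF U(1)]
          smooth_on_bilinear[OF U(1) bounded_bilinear_inner] smooth_on_bilinear[OF U(1) bounded_bilinear_smult]
          smooth_on_bilinear[OF U(1) bounded_bilinear_herm] smooth_on_const[OF U(1)] sn sj) (use n0 in auto)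
    then show "smooth_on U (\<lambda>x. line_proj \<phi> x v)"
      by (rule smooth_on_cong[OF U(1), THEN iffD2, rotated])
        (simp add: line_proj_apply[of \<phi>, OF U(6)[folded n_def] n0] hp_part_def inverse_eq_divide)
  qed
  then show "\<exists>U. open U \<and> p \<in> U \<and> smooth_on U (line_proj \<phi>)" using U by blast
qed

text \<open>The derivative of the projection exchanges the line and its orthogonal complement: it
  sends \<open>q\<close> to \<open>\<xi> X\<close>, and on horizontal vectors it is the adjoint of
  its restriction to the line. Together the formulas compute a product of two derivatives on
  \<open>q\<close>, hence the curvature.\<close>

lemma line_proj_derivative_chart:
  assumes sm: "smooth_map hline hp_hor M \<phi>" and p: "p \<in> M" and q: "norm q = 1" "hline q = \<phi> p"
    and U: "open U" "p \<in> U" "smooth_on U w" "\<forall>x\<in>U. w x \<in> hp_hor q \<and> \<phi> x = hline (q + w x)" "w p = 0"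
  defines "\<xi> \<equiv> frechet_derivative w (at p)"
  shows "frechet_derivative (line_proj \<phi>) (at p) X q = \<xi> X"
    and "\<xi> X \<in> hp_hor q"
    and "frechet_derivative (line_proj \<phi>) (at p) Y (\<xi> X) = herm (\<xi> X) (\<xi> Y) *s q + herm (\<xi> X) (jmul (\<xi> Y)) *s jmul q"
proof -
  have q0: "q \<noteq> 0" using q by auto
  have wH: "w x \<in> hp_hor q" and \<phi>_eq: "\<phi> x = hline (q + w x)" if "x \<in> U" for x using U(4) that by auto
  define n where "n x = q + w x" for x
  have n0: "n x \<noteq> 0" if "x \<in> U" for x unfolding n_def using chart_point_nz[OF q(1) wH[OF that]] .
  note P = line_proj_apply[of \<phi>, OF \<phi>_eq[folded n_def] n0]
  have dw: "(w has_derivative \<xi>) (at p)" unfolding \<xi>_def by (rule smooth_on_SucD[OF U(3,2)])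
  have dP: "(line_proj \<phi> has_derivative frechet_derivative (line_proj \<phi>) (at p)) (at p)"
    by (rule smooth_on_SucD[OF smooth_line_proj[OF sm] p])
  have dPv: "((\<lambda>x. line_proj \<phi> x v) has_derivative (\<lambda>X. frechet_derivative (line_proj \<phi>) (at p) X v)) (at p)" for v
    by (rule bounded_linear.has_derivative[OF bounded_bilinear.bounded_linear_left[OF bounded_bilinear_blinfun_apply] dP])
  have dn: "(n has_derivative \<xi>) (at p)" unfolding n_def[abs_def] using dw by (auto intro!: derivative_eq_intros)
  have \<xi>H: "\<xi> X \<in> hp_hor q" for X by (rule hp.derivative_in_H[OF q(1) U(1,2) wH dw])
  then show "\<xi> X \<in> hp_hor q" .
  have P\<xi>: "line_proj \<phi> p (\<xi> X) = 0" for X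
    using line_proj_apply[of \<phi>, OF q(2)[symmetric] q0] hp.mem_H_iff[OF q0] \<xi>H[of X] by simp
  have np: "n p = q" by (simp add: n_def U(5))
  \<comment> \<open>The relation \<open>P n = n\<close> is differentiated at \<open>p\<close>; the
    term \<open>P (\<xi> X)\<close> vanishes because \<open>\<xi> X\<close> is horizontal.\<close>
  have "((\<lambda>x. line_proj \<phi> x (n x)) has_derivative
      (\<lambda>X. line_proj \<phi> p (\<xi> X) + frechet_derivative (line_proj \<phi>) (at p) X (n p))) (at p)"
    by (rule bounded_bilinear.FDERIV[OF bounded_bilinear_blinfun_apply dP dn])
  then have "(n has_derivative (\<lambda>X. line_proj \<phi> p (\<xi> X) + frechet_derivative (line_proj \<phi>) (at p) X (n p))) (at p)"
    by (rule has_derivative_transform_within_open[OF _ U(1,2)]) (use n0 in \<open>simp add: P hp.T_self\<close>)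
  from has_derivative_unique[OF this dn] show "frechet_derivative (line_proj \<phi>) (at p) X q = \<xi> X"
    by (simp add: P\<xi> np fun_eq_iff)
  define c where "c = \<xi> X"
  have c: "herm c q = 0" "herm c (jmul q) = 0" using \<xi>H[of X] by (simp_all add: c_def hp_hor_def)
  have dh: "((\<lambda>x. herm c (w x) *s n x) has_derivative (\<lambda>Y. herm c (w p) *s \<xi> Y + herm c (\<xi> Y) *s n p)) (at p)"
    by (rule bounded_bilinear.FDERIV[OF bounded_bilinear_smult
          bounded_linear.has_derivative[OF bounded_bilinear.bounded_linear_right[OF bounded_bilinear_herm] dw] dn])
  have djw: "((\<lambda>x. jmul (w x)) has_derivative (\<lambda>Y. jmul (\<xi> Y))) (at p)"
    by (rule bounded_linear.has_derivative[OF bounded_linear_jmul dw])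
  have djn: "((\<lambda>x. jmul (n x)) has_derivative (\<lambda>Y. jmul (\<xi> Y))) (at p)"
    by (rule bounded_linear.has_derivative[OF bounded_linear_jmul dn])
  have dj: "((\<lambda>x. herm c (jmul (w x)) *s jmul (n x)) has_derivative
      (\<lambda>Y. herm c (jmul (w p)) *s jmul (\<xi> Y) + herm c (jmul (\<xi> Y)) *s jmul (n p))) (at p)"
    by (rule bounded_bilinear.FDERIV[OF bounded_bilinear_smult
          bounded_linear.has_derivative[OF bounded_bilinear.bounded_linear_right[OF bounded_bilinear_herm] djw] djn])
  have "((\<lambda>x. inverse (n x \<bullet> n x)) has_derivative
      (\<lambda>Y. - (inverse (n p \<bullet> n p) * (n p \<bullet> \<xi> Y + \<xi> Y \<bullet> n p) * inverse (n p \<bullet> n p)))) (at p)"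
    by (rule Deriv.has_derivative_inverse[OF _ has_derivative_inner[OF dn dn]]) (use n0[OF U(2)] in simp)
  \<comment> \<open>As \<open>w p = 0\<close>, every term in which \<open>herm c (w x)\<close> or
    \<open>herm c (jmul (w x))\<close> is left undifferentiated drops out at
    \<open>p\<close>.\<close>
  from has_derivative_scaleR[OF this has_derivative_add[OF dh dj]]
  have "((\<lambda>x. inverse (n x \<bullet> n x) *\<^sub>R (herm c (w x) *s n x + herm c (jmul (w x)) *s jmul (n x))) has_derivative
      (\<lambda>Y. herm c (\<xi> Y) *s q + herm c (jmul (\<xi> Y)) *s jmul q)) (at p)"
    using q(1) by (simp add: np U(5) dot_square_norm)
  then have "((\<lambda>x. line_proj \<phi> x c) has_derivative (\<lambda>Y. herm c (\<xi> Y) *s q + herm c (jmul (\<xi> Y)) *s jmul q)) (at p)"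
    by (rule has_derivative_transform_within_open[OF _ U(1,2)])
      (simp add: P hp_part_def n_def jmul_add herm_add_right c inverse_eq_divide)
  from has_derivative_unique[OF dPv[of c] this]
  show "frechet_derivative (line_proj \<phi>) (at p) Y (\<xi> X) = herm (\<xi> X) (\<xi> Y) *s q + herm (\<xi> X) (jmul (\<xi> Y)) *s jmul q"
    unfolding c_def by metis
qed

text \<open>At the centre of the chart \<open>\<omega>\<^sub>I\<close> is, up to sign, the imaginary
  part of \<open>herm\<close>, and \<open>\<omega>\<^sub>J\<close>, \<open>\<omega>\<^sub>K\<close>
  are the two real components of the symplectic form.\<close>

lemma hp_totally_real_herm:
  assumes "hp_totally_real M \<phi>" "p \<in> M" "norm q = 1" "hline q = \<phi> p"
    and \<xi>: "\<And>X. diff_map hline hp_hor q \<phi> p X = \<xi> X" "\<And>X. \<xi> X \<in> hp_hor q"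
  shows "herm (\<xi> X) (jmul (\<xi> Y)) = 0" "herm (\<xi> X) (\<xi> Y) = complex_of_real (\<xi> X \<bullet> \<xi> Y)"
proof -
  have tr: "quot_metric hp_hor q 0 (A (\<xi> X)) (\<xi> Y) = 0" if "form_pullback_zero hline hp_hor A M \<phi>" for A X Y
  proof -
    have "quot_metric hp_hor q (coord hline hp_hor q (\<phi> p)) (A (diff_map hline hp_hor q \<phi> p X)) (diff_map hline hp_hor q \<phi> p Y) = 0"
      using that assms(2-4) unfolding form_pullback_zero_def by auto
    then show ?thesis by (simp add: \<xi>(1) assms(4)[symmetric] hp.coord_base[OF assms(3)])
  qed
  have 1: "(\<i> *s \<xi> X) \<bullet> \<xi> Y = 0" for X Y
    using tr[of "\<lambda>v. \<i> *s v" X Y] assms(1) hp.quot_metric_base[OF assms(3) smult_mem_hp_hor[OF \<xi>(2)] \<xi>(2)]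
    by (simp add: hp_totally_real_def)
  have 2: "jmul (\<xi> X) \<bullet> \<xi> Y = 0" for X Y
    using tr[of jmul X Y] assms(1) hp.quot_metric_base[OF assms(3) jmul_mem_hp_hor[OF \<xi>(2)] \<xi>(2)]
    by (simp add: hp_totally_real_def)
  have 3: "(\<i> *s jmul (\<xi> X)) \<bullet> \<xi> Y = 0" for X Y
    using tr[of kmul X Y] assms(1) hp.quot_metric_base[OF assms(3) smult_mem_hp_hor[OF jmul_mem_hp_hor[OF \<xi>(2)]] \<xi>(2)]
    by (simp add: hp_totally_real_def kmul_def)
  show "herm (\<xi> X) (jmul (\<xi> Y)) = 0"
    by (rule complex_eqI) (simp_all add: Re_herm Im_herm inner_commute[of "\<xi> X"] 2 3)
  show "herm (\<xi> X) (\<xi> Y) = complex_of_real (\<xi> X \<bullet> \<xi> Y)"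
    by (rule complex_eqI) (simp_all add: Re_herm Im_herm inner_commute[of "\<xi> X" "\<i> *s _"] 1)
qed

text \<open>Total reality leaves only \<open>q\<close> times the real number
  \<open>\<xi> X \<bullet> \<xi> Y\<close>, which is symmetric in \<open>X\<close> and
  \<open>Y\<close>.\<close>

lemma line_proj_flat:
  assumes sm: "smooth_map hline hp_hor M \<phi>" and tr: "hp_totally_real M \<phi>" and p: "p \<in> M" and q: "norm q = 1" "hline q = \<phi> p"
  shows "frechet_derivative (line_proj \<phi>) (at p) X (frechet_derivative (line_proj \<phi>) (at p) Y q)
       = frechet_derivative (line_proj \<phi>) (at p) Y (frechet_derivative (line_proj \<phi>) (at p) X q)"
proof -
  obtain U w where U: "open U" "p \<in> U" "smooth_on U w" "\<forall>x\<in>U. w x \<in> hp_hor q \<and> \<phi> x = hline (q + w x)" "w p = 0"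
    "\<And>x Z. x \<in> U \<Longrightarrow> diff_map hline hp_hor q \<phi> x Z = frechet_derivative w (at x) Z"
    using hp.chart_at[OF sm p q] by metis
  note D = line_proj_derivative_chart[OF sm p q U(1-5)]
  note t = hp_totally_real_herm[OF tr p q U(6)[OF U(2)] D(2)]
  show ?thesis unfolding D(1) D(3) t by (simp add: inner_commute)
qed

text \<open>This is how solutions of \<open>ds = dP s\<close> are seen to be horizontal.\<close>

lemma line_proj_derivative_horizontal:
  assumes sm: "smooth_map hline hp_hor M \<phi>" and p: "p \<in> M" and q: "norm q = 1" "hline q = \<phi> p"
  shows "frechet_derivative (line_proj \<phi>) (at p) X q \<in> hp_hor q"
proof -
  obtain U w where U: "open U" "p \<in> U" "smooth_on U w" "\<forall>x\<in>U. w x \<in> hp_hor q \<and> \<phi> x = hline (q + w x)" "w p = 0"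
    using hp.chart_at[OF sm p q] by metis
  note D = line_proj_derivative_chart[OF sm p q U]
  show ?thesis unfolding D(1) by (rule D(2))
qed

section \<open>Integration over a simply connected domain\<close>

lemma simply_connected_convex_model:
  assumes "open M" "simply_connected M" "M \<noteq> {}"
  obtains N F G where "open N" "convex N" "(0::complex) \<in> N" "F holomorphic_on M" "G holomorphic_on N"
    "F ` M \<subseteq> N" "G ` N \<subseteq> M" "\<And>z. z \<in> M \<Longrightarrow> G (F z) = z"
proof -
  \<comment> \<open>The plane is not biholomorphic to the disc and forms its own case; both models
    are convex and contain \<open>0\<close>.\<close>
  consider "M = UNIV" | F G where "F holomorphic_on M" "G holomorphic_on ball 0 1"
      "\<forall>z\<in>M. F z \<in> ball 0 1 \<and> G (F z) = z" "\<forall>z\<in>ball 0 1. G z \<in> M \<and> F (G z) = z"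
    using Riemann_mapping_theorem[of M] assms by blast
  then show thesis
  proof cases
    case 1
    show thesis by (rule that[of UNIV "\<lambda>z. z" "\<lambda>z. z"]) (auto simp: 1)
  next
    case 2
    show thesis by (rule that[of "ball 0 1" F G]) (use 2 in auto)
  qed
qed

definition horizontal_lift :: "complex set \<Rightarrow> (complex \<Rightarrow> (complex ^ ('m::finite \<times> 2)) set) \<Rightarrow>
    (complex \<Rightarrow> complex ^ ('m \<times> 2)) \<Rightarrow> bool" where
  "horizontal_lift M \<phi> s \<longleftrightarrow> smooth_on M s \<and> (\<forall>z\<in>M. norm (s z) = 1 \<and> hline (s z) = \<phi> z \<and>
     (\<forall>X. frechet_derivative s (at z) X \<in> hp_hor (s z)))"

lemma horizontal_liftD:
  assumes "horizontal_lift M \<phi> s"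
  shows "smooth_on M s" "\<And>z. z \<in> M \<Longrightarrow> norm (s z) = 1" "\<And>z. z \<in> M \<Longrightarrow> hline (s z) = \<phi> z"
    "\<And>z X. z \<in> M \<Longrightarrow> frechet_derivative s (at z) X \<in> hp_hor (s z)"
  using assms by (auto simp: horizontal_lift_def)

lemma horizontal_lift_exists:
  fixes \<phi> :: "complex \<Rightarrow> (complex ^ ('m::finite \<times> 2)) set"
  assumes M: "open M" "simply_connected M" and sm: "smooth_map hline hp_hor M \<phi>" and tr: "hp_totally_real M \<phi>"
  obtains s where "horizontal_lift M \<phi> s"
proof (cases "M = {}")
  case True
  show thesis by (rule that[of "\<lambda>_. 0"]) (use True smooth_on_const[of "{}"] in \<open>simp add: horizontal_lift_def\<close>)
next
  case False
  obtain N F G where N: "open N" "convex N" "(0::complex) \<in> N" and F: "F holomorphic_on M" and G: "G holomorphic_on N"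
    and FG: "F ` M \<subseteq> N" "G ` N \<subseteq> M" "\<And>z. z \<in> M \<Longrightarrow> G (F z) = z"
    using simply_connected_convex_model[OF M False] by metis
  define P where "P = line_proj \<phi>"
  define P' where "P' x = frechet_derivative P (at x)" for x
  define Q where "Q y = P (G y)" for y
  define Q' where "Q' y = Blinfun (frechet_derivative Q (at y))" for y
  have sP: "smooth_on M P" unfolding P_def by (rule smooth_line_proj[OF sm])
  have dP: "(P has_derivative P' x) (at x)" if "x \<in> M" for x
    unfolding P'_def by (rule smooth_on_SucD[OF sP that])
  have sQ: "smooth_on N Q"
    unfolding Q_def[abs_def] by (rule smooth_on_compose[OF N(1) sP smooth_on_holomorphic[OF N(1) G] FG(2)])
  have dQ: "(Q has_derivative Q' y) (at y)" if "y \<in> N" for y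
    using smooth_on_SucD[OF sQ that] has_derivative_bounded_linear[OF smooth_on_SucD[OF sQ that]]
    by (simp add: Q'_def bounded_linear_Blinfun_apply)
  \<comment> \<open>By the chain rule \<open>h X\<close> is \<open>deriv G y * X\<close>. The bare
    existence of such a direction suffices to transfer flatness from \<open>P\<close> to
    \<open>Q\<close>.\<close>
  have Q'P': "\<exists>h. \<forall>X. Q' y X = P' (G y) (h X)" if y: "y \<in> N" for y
  proof -
    have "(G has_derivative (\<lambda>v. deriv G y * v)) (at y)"
      using holomorphic_derivI[OF G N(1) y] by (simp add: has_field_derivative_def)
    from has_derivative_compose[OF this, of P] dP FG(2) y
    have "(Q has_derivative (\<lambda>v. P' (G y) (deriv G y * v))) (at y)" unfolding Q_def[abs_def] by blast
    from has_derivative_unique[OF dQ[OF y] this] show ?thesis by (metis (no_types))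
  qed
  have unit: "\<exists>n. \<phi> x = hline n \<and> n \<noteq> 0" if "x \<in> M" for x
    using smooth_map_unit[OF sm that] by metis
  obtain s0 where s0: "norm s0 = 1" "\<phi> (G 0) = hline s0" "s0 \<noteq> 0"
    using smooth_map_unit[OF sm] FG(2) N(3) by (metis image_subset_iff)
  obtain r where r: "\<And>y. y \<in> N \<Longrightarrow> Q y (r y) = r y" "\<And>y. y \<in> N \<Longrightarrow> norm (r y) = 1"
    "\<And>y. y \<in> N \<Longrightarrow> (r has_derivative (\<lambda>X. Q' y X (r y))) (at y)"
  proof (rule parallel_section_convex[OF N dQ])
    show "continuous_on N Q'" unfolding Q'_def[abs_def]
      by (rule smooth_on_continuous[OF smooth_on_Blinfun_derivative[OF N(1) sQ]])
    show "Q y (Q y v) = Q y v" if "y \<in> N" for y v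
      unfolding Q_def P_def using unit[of "G y"] FG(2) that line_proj_idem by blast
    show "Q y v \<bullet> w = v \<bullet> Q y w" if "y \<in> N" for y v w
      unfolding Q_def P_def using unit[of "G y"] FG(2) that line_proj_self_adjoint by blast
    show "Q' y X (Q' y Y v) = Q' y Y (Q' y X v)" if y: "y \<in> N" and v: "norm v = 1" "Q y v = v" for y v X Y
    proof -
      have Gy: "G y \<in> M" using FG(2) y by blast
      have "v \<noteq> 0" using v by auto
      then have "hline v = \<phi> (G y)" using unit[OF Gy] line_proj_fixed[of \<phi> "G y" _ v] v(2) unfolding Q_def P_def by blast
      from line_proj_flat[OF sm tr Gy v(1) this] Q'P'[OF y] show ?thesis
        unfolding P'_def P_def by metis
    qed
    show "Q 0 s0 = s0" using line_proj_apply[of \<phi>, OF s0(2,3), of s0] s0(3) by (simp add: Q_def P_def hp.T_self)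
  qed (blast intro: s0(1))+
  define s where "s z = r (F z)" for z
  have FN: "F z \<in> N" if "z \<in> M" for z using FG(1) that by blast
  have ns: "norm (s z) = 1" if "z \<in> M" for z using r(2)[OF FN[OF that]] by (simp add: s_def)
  have Ps: "P z (s z) = s z" if "z \<in> M" for z
    using r(1)[OF FN[OF that]] FG(3)[OF that] by (simp add: s_def Q_def)
  have ds: "(s has_derivative (\<lambda>X. P' z X (s z))) (at z)" if z: "z \<in> M" for z
  proof -
    have dF: "(F has_derivative (\<lambda>v. deriv F z * v)) (at z)"
      using holomorphic_derivI[OF F M(1) z] by (simp add: has_field_derivative_def)
    have "((\<lambda>z. Q (F z)) has_derivative (\<lambda>v. Q' (F z) (deriv F z * v))) (at z)"
      by (rule has_derivative_compose[where g=Q, OF dF dQ[OF FN[OF z]]])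
    \<comment> \<open>Since \<open>Q (F z) = P z\<close> on \<open>M\<close>, the chain rule turns
      the equation for \<open>r\<close> into the one for \<open>s\<close>.\<close>
    then have "(P has_derivative (\<lambda>v. Q' (F z) (deriv F z * v))) (at z)"
      by (rule has_derivative_transform_within_open[OF _ M(1) z]) (simp add: Q_def FG(3))
    from has_derivative_unique[OF this dP[OF z]] have eq: "Q' (F z) (deriv F z * v) = P' z v" for v by metis
    have "((\<lambda>z. r (F z)) has_derivative (\<lambda>v. Q' (F z) (deriv F z * v) (r (F z)))) (at z)"
      by (rule has_derivative_compose[where g=r, OF dF r(3)[OF FN[OF z]]])
    then show ?thesis by (simp add: eq s_def[abs_def])
  qed
  \<comment> \<open>Bootstrapping: in \<open>ds = dP s\<close> the coefficient is smooth, so order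
    \<open>k\<close> of \<open>s\<close> gives order \<open>Suc k\<close>.\<close>
  have "Ck_on k M s" for k
  proof (induction k)
    case 0
    show ?case using ds by (auto intro!: continuous_at_imp_continuous_on has_derivative_continuous)
  next
    case (Suc k)
    show ?case
      by (rule Ck_on_SucI[OF M(1) ds])
        (use Suc smooth_on_deriv[OF sP] in \<open>auto intro!: Ck_on_bilinear[OF M(1) bounded_bilinear_blinfun_apply] simp: P'_def smooth_on_def\<close>)
  qed
  then have ss: "smooth_on M s" by (simp add: smooth_on_def)
  have hs: "hline (s z) = \<phi> z" if z: "z \<in> M" for z
  proof -
    have "s z \<noteq> 0" using ns[OF z] by auto
    then show ?thesis using unit[OF z] line_proj_fixed[of \<phi> z _ "s z"] Ps[OF z] unfolding P_def by blast
  qed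
  have "frechet_derivative s (at z) X \<in> hp_hor (s z)" if z: "z \<in> M" for z X
  proof -
    have "frechet_derivative s (at z) X = P' z X (s z)" using frechet_derivative_at[OF ds[OF z]] by metis
    then show ?thesis
      using line_proj_derivative_horizontal[OF sm z ns[OF z] hs[OF z], of X] by (simp add: P'_def P_def)
  qed
  then show thesis using that ss ns hs unfolding horizontal_lift_def by blast
qed

section \<open>The lift in complex projective space\<close>

lemma cline_smult:
  assumes "c \<noteq> 0" shows "cline (c *s v) = cline v"
proof (intro equalityI subsetI)
  fix x assume "x \<in> cline (c *s v)"
  then obtain a where "x = a *s (c *s v)" unfolding cline_def by blast
  then have "x = (a * c) *s v" by (simp add: vector_smult_assoc)
  then show "x \<in> cline v" unfolding cline_def by blast
next
  fix x assume "x \<in> cline v"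
  then obtain a where "x = a *s v" unfolding cline_def by blast
  then have "x = (a * inverse c) *s (c *s v)" using assms by (simp add: vector_smult_assoc)
  then show "x \<in> cline (c *s v)" unfolding cline_def by blast
qed

lemma twistor_cline: "twistor (cline v) = hline v"
proof (intro equalityI subsetI)
  fix x assume "x \<in> twistor (cline v)"
  then obtain a b where "x = a *s v + jmul (b *s v)" unfolding twistor_def cline_def by blast
  then show "x \<in> hline v" unfolding hline_def jmul_smult by blast
next
  fix x assume "x \<in> hline v"
  then obtain a b where "x = a *s v + b *s jmul v" unfolding hline_def by blast
  then have "x = a *s v + jmul (cnj b *s v)" by (simp add: jmul_smult)
  then show "x \<in> twistor (cline v)" unfolding twistor_def cline_def by blast
qed

lemma has_derivative_herm_left:
  "(f has_derivative f') F \<Longrightarrow> ((\<lambda>x. herm (f x) c) has_derivative (\<lambda>h. herm (f' h) c)) F"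
  by (rule bounded_linear.has_derivative[OF bounded_bilinear.bounded_linear_left[OF bounded_bilinear_herm]])

text \<open>
  The two coordinate functions differ by a multiple of \<open>herm (r x) (jmul q)\<close>, which vanishes to
  second order at \<open>p\<close>: differentiating \<open>herm (dr Y) (jmul r) = 0\<close> turns its Hessian into
  \<open>- herm (dr Y) (jmul (dr X))\<close>, and this is zero because \<open>\<phi>\<close> is totally real.
\<close>

lemma horizontal_lift_chart:
  fixes r :: "complex \<Rightarrow> complex ^ ('m::finite \<times> 2)"
  assumes M: "open M" and sm: "smooth_map hline hp_hor M \<phi>" and tr: "hp_totally_real M \<phi>"
    and lift: "horizontal_lift M \<phi> r"
    and p: "p \<in> M" and q: "q = r p"
  shows "\<exists>U. open U \<and> p \<in> U \<and> U \<subseteq> M \<and> (\<lambda>z. cline (r z)) ` U \<subseteq> chart_dom cline cp_hor q \<and>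
      smooth_on U (\<lambda>x. coord cline cp_hor q (cline (r x)))"
    and "diff_map cline cp_hor q (\<lambda>z. cline (r z)) p X = diff_map hline hp_hor q \<phi> p X"
    and "diff_map hline hp_hor q \<phi> p X \<in> hp_hor q"
    and "second_ff cline cp_hor g q (\<lambda>z. cline (r z)) p X Y = second_ff hline hp_hor g q \<phi> p X Y"
proof -
  note sr = horizontal_liftD(1)[OF lift] and nr = horizontal_liftD(2)[OF lift]
    and hr = horizontal_liftD(3)[OF lift] and hor = horizontal_liftD(4)[OF lift]
  have nq: "norm q = 1" using nr[OF p] q by simp
  have "q \<bullet> q = 1" using nq by (simp add: dot_square_norm)
  then have qq: "herm q q = 1" "herm (jmul q) (jmul q) = 1" by (simp_all add: herm_self inner_jmul_jmul)
  \<comment> \<open>\<open>a x + b x j\<close> will be the quaternion that carries the chart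
    representative \<open>q + w x\<close> of \<open>\<phi> x\<close> to \<open>r x\<close>. The
    complex chart is available where \<open>a\<close> does not vanish.\<close>
  define a where "a x = herm (r x) q" for x
  define b where "b x = herm (r x) (jmul q)" for x
  define r' where "r' x = frechet_derivative r (at x)" for x
  have dr: "(r has_derivative r' x) (at x)" if "x \<in> M" for x
    unfolding r'_def by (rule smooth_on_SucD[OF sr that])
  have sa: "smooth_on M a" and sb: "smooth_on M b" unfolding a_def b_def
    by (intro smooth_on_bilinear[OF M bounded_bilinear_herm] sr smooth_on_const M)+
  have ap: "a p = 1" and bp: "b p = 0" using qq by (simp_all add: a_def b_def q[symmetric])
  have hor': "herm (r' p Z) q = 0" "herm (r' p Z) (jmul q) = 0" for Z
    using hor[OF p, of Z] by (simp_all add: r'_def hp_hor_def q)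

  define U where "U = {x \<in> M. a x \<noteq> 0}"
  have U: "open U" "p \<in> U" "U \<subseteq> M"
  proof -
    have "open (M \<inter> a -` (- {0}))"
      by (rule continuous_open_preimage[OF smooth_on_continuous[OF sa] M]) auto
    moreover have "U = M \<inter> a -` (- {0})" by (auto simp: U_def)
    ultimately show "open U" by simp
  qed (use p ap in \<open>auto simp: U_def\<close>)
  define wt where "wt x = inverse (a x) *s r x - q" for x
  have swt: "smooth_on U wt" unfolding wt_def
    by (intro smooth_on_diff[OF U(1)] smooth_on_bilinear[OF U(1) bounded_bilinear_smult] smooth_on_inverse[OF U(1)]
        smooth_on_const[OF U(1)] smooth_on_subset[OF sa U(3)] smooth_on_subset[OF sr U(3)]) (simp add: U_def)
  have wtH: "wt x \<in> cp_hor q" if "x \<in> U" for x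
    using that qq by (simp add: wt_def cp_hor_def herm_diff_left herm_smult_left U_def a_def)
  have wtL: "cline (r x) = cline (q + wt x)" if "x \<in> U" for x
    using that cline_smult[of "inverse (a x)" "r x"] by (simp add: wt_def U_def)
  have wtc: "coord cline cp_hor q (cline (r x)) = wt x" if "x \<in> U" for x
    unfolding wtL[OF that] by (rule cp.coord_eq[OF nq wtH[OF that]])
  show "\<exists>U. open U \<and> p \<in> U \<and> U \<subseteq> M \<and> (\<lambda>z. cline (r z)) ` U \<subseteq> chart_dom cline cp_hor q \<and>
      smooth_on U (\<lambda>x. coord cline cp_hor q (cline (r x)))"
  proof (intro exI conjI)
    show "(\<lambda>z. cline (r z)) ` U \<subseteq> chart_dom cline cp_hor q"
      unfolding chart_dom_def using wtL wtH by blast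
    show "smooth_on U (\<lambda>x. coord cline cp_hor q (cline (r x)))"
      by (rule smooth_on_cong[OF U(1), THEN iffD2, OF _ swt]) (rule wtc)
  qed (rule U)+

  obtain U0 w where U0: "open U0" "p \<in> U0" "U0 \<subseteq> M" "smooth_on U0 w" "\<And>x. x \<in> U0 \<Longrightarrow> w x \<in> hp_hor q"
    "\<And>x. x \<in> U0 \<Longrightarrow> \<phi> x = hline (q + w x)" "\<And>x. x \<in> U0 \<Longrightarrow> coord hline hp_hor q (\<phi> x) = w x" "w p = 0"
    "\<And>x Z. x \<in> U0 \<Longrightarrow> diff_map hline hp_hor q \<phi> x Z = frechet_derivative w (at x) Z"
    using hp.chart_at[OF sm p nq, of thesis] hr[OF p] q by metis
  define V where "V = U \<inter> U0"
  have V: "open V" "p \<in> V" "V \<subseteq> U" "V \<subseteq> U0" "V \<subseteq> M" using U U0 by (auto simp: V_def)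
  define m where "m x = inverse (a x) *s jmul (q + w x)" for x
  have sm': "smooth_on V m" unfolding m_def
    by (intro smooth_on_bilinear[OF V(1) bounded_bilinear_smult] smooth_on_inverse[OF V(1)]
        smooth_on_bounded_linear[OF V(1) bounded_linear_jmul] smooth_on_add[OF V(1)]
        smooth_on_const[OF V(1)] smooth_on_subset[OF sa V(5)] smooth_on_subset[OF U0(4) V(4)])
      (use V(3) in \<open>auto simp: U_def\<close>)
  have wt_w: "wt x = w x + b x *s m x" if x: "x \<in> V" for x
  proof -
    have xM: "x \<in> M" and ax: "a x \<noteq> 0" and x0: "x \<in> U0" using x V by (auto simp: U_def)
    have "r x \<in> hline (q + w x)" using hr[OF xM] U0(6)[OF x0] hline_self by metis
    then obtain \<alpha> \<beta> where eq: "r x = \<alpha> *s (q + w x) + \<beta> *s jmul (q + w x)" unfolding hline_def by blast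
    have h: "herm (w x) q = 0" "herm (w x) (jmul q) = 0" "herm (jmul (w x)) q = 0" "herm (jmul (w x)) (jmul q) = 0"
      using U0(5)[OF x0] jmul_mem_hp_hor[OF U0(5)[OF x0]] by (simp_all add: hp_hor_def)
    have "a x = \<alpha>" "b x = \<beta>"
      unfolding a_def b_def eq by (simp_all add: herm_add_left herm_smult_left jmul_add qq h)
    then show ?thesis
      using ax by (simp add: wt_def eq m_def vector_add_ldistrib vector_smult_assoc mult.commute)
  qed

  define w' where "w' x = frechet_derivative w (at x)" for x
  define m' where "m' x = frechet_derivative m (at x)" for x
  have dw: "(w has_derivative w' x) (at x)" if "x \<in> V" for x
    unfolding w'_def using smooth_on_SucD[OF U0(4)] V(4) that by blast
  have dm: "(m has_derivative m' x) (at x)" if "x \<in> V" for x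
    unfolding m'_def by (rule smooth_on_SucD[OF sm' that])
  have db: "(b has_derivative (\<lambda>Z. herm (r' x Z) (jmul q))) (at x)" if "x \<in> M" for x
    unfolding b_def[abs_def] by (rule has_derivative_herm_left[OF dr[OF that]])
  have dwt: "frechet_derivative wt (at x) = (\<lambda>Z. w' x Z + (b x *s m' x Z + herm (r' x Z) (jmul q) *s m x))"
    if x: "x \<in> V" for x
  proof -
    have xM: "x \<in> M" using x V by blast
    have "((\<lambda>x. w x + b x *s m x) has_derivative
        (\<lambda>Z. w' x Z + (b x *s m' x Z + herm (r' x Z) (jmul q) *s m x))) (at x)"
      by (rule has_derivative_add[OF dw[OF x] bounded_bilinear.FDERIV[OF bounded_bilinear_smult db[OF xM] dm[OF x]]])
    then have "(wt has_derivative (\<lambda>Z. w' x Z + (b x *s m' x Z + herm (r' x Z) (jmul q) *s m x))) (at x)"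
      by (rule has_derivative_transform_within_open[OF _ V(1) x]) (simp add: wt_w)
    then show ?thesis by (rule frechet_derivative_at[symmetric])
  qed
  have dwt_p: "frechet_derivative wt (at p) = w' p"
    unfolding dwt[OF V(2)] bp hor' by simp

  \<comment> \<open>Horizontality makes the derivative of \<open>a\<close> vanish at
    \<open>p\<close>, where \<open>a\<close> is \<open>1\<close>, so \<open>r\<close> and its
    normalisation \<open>q + wt\<close> have the same derivative there.\<close>
  have r'w: "r' p = w' p"
  proof -
    have "((\<lambda>x. a x *s (q + wt x)) has_derivative
        (\<lambda>Z. a p *s (0 + frechet_derivative wt (at p) Z) + herm (r' p Z) q *s (q + wt p))) (at p)"
      unfolding a_def[abs_def]
      by (rule bounded_bilinear.FDERIV[OF bounded_bilinear_smult has_derivative_herm_left[OF dr[OF p]]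
            has_derivative_add[OF has_derivative_const smooth_on_SucD[OF swt U(2)]]])
    then have "(r has_derivative (\<lambda>Z. a p *s (0 + frechet_derivative wt (at p) Z) + herm (r' p Z) q *s (q + wt p))) (at p)"
      by (rule has_derivative_transform_within_open[OF _ U(1,2)]) (simp add: wt_def vector_smult_assoc U_def)
    from has_derivative_unique[OF dr[OF p] this] show ?thesis
      by (simp add: fun_eq_iff ap hor' dwt_p)
  qed

  have hp_diff: "diff_map hline hp_hor q \<phi> p Z = w' p Z" for Z
    using U0(9)[OF U0(2)] by (simp add: w'_def)
  have w'H: "w' p Z \<in> hp_hor q" for Z
    by (rule hp.derivative_in_H[OF nq U0(1,2,5) dw[OF V(2)]])
  show "diff_map hline hp_hor q \<phi> p X \<in> hp_hor q" unfolding hp_diff by (rule w'H)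
  have "diff_map cline cp_hor q (\<lambda>z. cline (r z)) p Z = frechet_derivative wt (at p) Z" for Z
    unfolding diff_map_def using frechet_cong_open(2)[OF U(1,2), of "\<lambda>x. coord cline cp_hor q (cline (r x))" wt] wtc by simp
  then show "diff_map cline cp_hor q (\<lambda>z. cline (r z)) p X = diff_map hline hp_hor q \<phi> p X"
    by (simp add: hp_diff dwt_p)

  define r'' where "r'' = frechet_derivative (\<lambda>x. r' x Y) (at p)"
  have dr'Y: "((\<lambda>x. r' x Y) has_derivative r'') (at p)"
    unfolding r''_def r'_def by (rule smooth_on_SucD[OF smooth_on_deriv[OF sr] p])
  have r''0: "herm (r'' Z) (jmul q) = 0" for Z
  proof -
    have "((\<lambda>x. herm (r' x Y) (jmul (r x))) has_derivative
        (\<lambda>Z. herm (r' p Y) (jmul (r' p Z)) + herm (r'' Z) (jmul (r p)))) (at p)"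
      by (rule bounded_bilinear.FDERIV[OF bounded_bilinear_herm dr'Y
            bounded_linear.has_derivative[OF bounded_linear_jmul dr[OF p]]])
    moreover have "((\<lambda>x. herm (r' x Y) (jmul (r x))) has_derivative (\<lambda>Z. 0)) (at p)"
      by (rule has_derivative_transform_within_open[OF has_derivative_const[of 0] M p])
        (use hor in \<open>simp add: hp_hor_def r'_def\<close>)
    ultimately have "(\<lambda>Z. herm (r' p Y) (jmul (r' p Z)) + herm (r'' Z) (jmul (r p))) = (\<lambda>Z. 0)"
      by (rule has_derivative_unique)
    then have "herm (r' p Y) (jmul (r' p Z)) + herm (r'' Z) (jmul (r p)) = 0" by (rule fun_cong)
    moreover have "herm (r' p Y) (jmul (r' p Z)) = 0"
      unfolding r'w using hp_totally_real_herm(1)[OF tr p nq _ hp_diff w'H] hr[OF p] q by simp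
    ultimately show ?thesis by (simp add: q)
  qed

  define w'' where "w'' = frechet_derivative (\<lambda>x. w' x Y) (at p)"
  have dw'Y: "((\<lambda>x. w' x Y) has_derivative w'') (at p)"
    unfolding w''_def w'_def by (rule smooth_on_SucD[OF smooth_on_deriv[OF U0(4)] U0(2)])
  have dm'Y: "((\<lambda>x. m' x Y) has_derivative frechet_derivative (\<lambda>x. m' x Y) (at p)) (at p)"
    unfolding m'_def by (rule smooth_on_SucD[OF smooth_on_deriv[OF sm'] V(2)])
  \<comment> \<open>Each summand besides \<open>w''\<close> carries the value of \<open>b\<close> at
    \<open>p\<close> or one of its first or second derivatives there, all of which are zero.\<close>
  have "((\<lambda>x. w' x Y + (b x *s m' x Y + herm (r' x Y) (jmul q) *s m x)) has_derivative
      (\<lambda>Z. w'' Z + ((b p *s frechet_derivative (\<lambda>x. m' x Y) (at p) Z + herm (r' p Z) (jmul q) *s m' p Y)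
        + (herm (r' p Y) (jmul q) *s m' p Z + herm (r'' Z) (jmul q) *s m p)))) (at p)"
    by (intro has_derivative_add dw'Y bounded_bilinear.FDERIV[OF bounded_bilinear_smult db[OF p] dm'Y]
        bounded_bilinear.FDERIV[OF bounded_bilinear_smult has_derivative_herm_left[OF dr'Y] dm[OF V(2)]])
  then have "((\<lambda>x. w' x Y + (b x *s m' x Y + herm (r' x Y) (jmul q) *s m x)) has_derivative w'') (at p)"
    by (simp add: bp hor' r''0)
  then have "((\<lambda>x. frechet_derivative wt (at x) Y) has_derivative w'') (at p)"
    by (rule has_derivative_transform_within_open[OF _ V(1,2)]) (simp add: dwt)
  then have D2: "frechet_derivative (\<lambda>x. frechet_derivative wt (at x) Y) (at p) = w''"
    by (rule frechet_derivative_at[symmetric])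

  have "second_ff cline cp_hor g q (\<lambda>z. cline (r z)) p X Y =
      frechet_derivative (\<lambda>x. frechet_derivative wt (at x) Y) (at p) X
      - frechet_derivative wt (at p) (christoffel UNIV g p X Y)"
    by (rule cp.second_ff_eq[where f="\<lambda>z. cline (r z)", OF nq _ U(1,2) wtH wtc swt]) (simp_all add: q)
  moreover have "second_ff hline hp_hor g q \<phi> p X Y =
      frechet_derivative (\<lambda>x. frechet_derivative w (at x) Y) (at p) X
      - frechet_derivative w (at p) (christoffel UNIV g p X Y)"
    by (rule hp.second_ff_eq[OF nq _ U0(1,2,5,7,4)]) (simp_all add: q hr p)
  ultimately show "second_ff cline cp_hor g q (\<lambda>z. cline (r z)) p X Y = second_ff hline hp_hor g q \<phi> p X Y"
    unfolding D2 dwt_p by (simp add: w''_def w'_def)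
qed

text \<open>The conditions on the lifted map range over the whole circle of unit vectors
  \<open>q\<close> spanning \<open>cline (s p)\<close>. Such a \<open>q\<close> is
  \<open>c *s s p\<close> with \<open>c\<close> of modulus one, and the constant multiple
  \<open>c *s s\<close> is again a horizontal lift with the same complex lines, now passing through
  \<open>q\<close>.\<close>

lemma horizontal_lift_fibre_chart:
  fixes s :: "complex \<Rightarrow> complex ^ ('m::finite \<times> 2)"
  assumes M: "open M" and sm: "smooth_map hline hp_hor M \<phi>" and tr: "hp_totally_real M \<phi>"
    and lift: "horizontal_lift M \<phi> s"
    and p: "p \<in> M" and q: "norm q = 1" "cline q = cline (s p)"
  shows "hline q = \<phi> p"
    and "\<exists>U. open U \<and> p \<in> U \<and> U \<subseteq> M \<and> (\<lambda>z. cline (s z)) ` U \<subseteq> chart_dom cline cp_hor q \<and>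
      smooth_on U (\<lambda>x. coord cline cp_hor q (cline (s x)))"
    and "diff_map cline cp_hor q (\<lambda>z. cline (s z)) p X = diff_map hline hp_hor q \<phi> p X"
    and "diff_map hline hp_hor q \<phi> p X \<in> hp_hor q"
    and "second_ff cline cp_hor g q (\<lambda>z. cline (s z)) p X Y = second_ff hline hp_hor g q \<phi> p X Y"
proof -
  note ss = horizontal_liftD(1)[OF lift] and ns = horizontal_liftD(2)[OF lift]
    and hs = horizontal_liftD(3)[OF lift] and hor = horizontal_liftD(4)[OF lift]
  have "q = 1 *s q" by simp
  then have "q \<in> cline q" unfolding cline_def by blast
  then obtain c where c: "q = c *s s p" using q(2) unfolding cline_def by blast
  have "complex_of_real (q \<bullet> q) = c * cnj c * complex_of_real (s p \<bullet> s p)"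
    unfolding herm_self[symmetric] c by (simp add: herm_smult_left herm_smult_right)
  then have cc: "c * cnj c = 1" using q(1) ns[OF p] by (simp add: dot_square_norm)
  then have c0: "c \<noteq> 0" by auto
  define r where "r z = c *s s z" for z
  have sr: "smooth_on M r" unfolding r_def
    by (intro smooth_on_bilinear[OF M bounded_bilinear_smult] smooth_on_const M ss)
  have nr: "norm (r z) = 1" if "z \<in> M" for z
  proof -
    have "complex_of_real (r z \<bullet> r z) = c * cnj c * complex_of_real (s z \<bullet> s z)"
      unfolding herm_self[symmetric] r_def by (simp add: herm_smult_left herm_smult_right)
    then have "complex_of_real (r z \<bullet> r z) = 1" using ns[OF that] by (simp only: cc dot_square_norm) simp
    then have "r z \<bullet> r z = 1" by (simp only: of_real_eq_1_iff)
    then show ?thesis by (simp add: norm_eq_sqrt_inner)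
  qed
  have hr: "hline (r z) = \<phi> z" if "z \<in> M" for z
  proof -
    have "r z = c *s s z + 0 *s jmul (s z)" by (simp add: r_def)
    then have "r z \<in> hline (s z)" unfolding hline_def by blast
    moreover have "r z \<noteq> 0" using nr[OF that] by auto
    ultimately show ?thesis using hline_eq hs[OF that] by metis
  qed
  have horr: "frechet_derivative r (at z) X \<in> hp_hor (r z)" if z: "z \<in> M" for z X
  proof -
    have "(r has_derivative (\<lambda>Z. c *s frechet_derivative s (at z) Z)) (at z)"
      unfolding r_def[abs_def]
      by (rule bounded_linear.has_derivative[OF bounded_bilinear.bounded_linear_right[OF bounded_bilinear_smult] smooth_on_SucD[OF ss z]])
    then have "frechet_derivative r (at z) X = c *s frechet_derivative s (at z) X"
      using frechet_derivative_at by metis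
    then show ?thesis using hor[OF z, of X]
      by (simp add: hp_hor_def r_def jmul_smult herm_smult_left herm_smult_right)
  qed
  have qr: "q = r p" by (simp add: c r_def)
  have eq: "(\<lambda>z. cline (s z)) = (\<lambda>z. cline (r z))" unfolding r_def cline_smult[OF c0] ..
  have "horizontal_lift M \<phi> r" using sr nr hr horr by (simp add: horizontal_lift_def)
  note R = horizontal_lift_chart[OF M sm tr this p qr]
  show "hline q = \<phi> p" unfolding qr by (rule hr[OF p])
  show "\<exists>U. open U \<and> p \<in> U \<and> U \<subseteq> M \<and> (\<lambda>z. cline (s z)) ` U \<subseteq> chart_dom cline cp_hor q \<and>
      smooth_on U (\<lambda>x. coord cline cp_hor q (cline (s x)))"
    using R(1) unfolding r_def cline_smult[OF c0] .
  show "diff_map cline cp_hor q (\<lambda>z. cline (s z)) p X = diff_map hline hp_hor q \<phi> p X"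
    unfolding eq by (rule R(2))
  show "diff_map hline hp_hor q \<phi> p X \<in> hp_hor q" by (rule R(3))
  show "second_ff cline cp_hor g q (\<lambda>z. cline (s z)) p X Y = second_ff hline hp_hor g q \<phi> p X Y"
    unfolding eq by (rule R(4))
qed

theorem theorem3p4:
  fixes M :: "complex set"
    and g :: "complex \<Rightarrow> complex \<Rightarrow> complex \<Rightarrow> real"
    and \<phi> :: "complex \<Rightarrow> (complex ^ ('m::finite \<times> 2)) set"
  assumes "open M" and "connected M" and "simply_connected M"
    and "conformal_metric_on M g"
    and "isometric_immersion hline hp_hor M g \<phi>"
    and "minimal hline hp_hor M g \<phi>"
    and "hp_totally_real M \<phi>"
    and "linearly_full M \<phi>"
  shows "\<exists>s :: complex \<Rightarrow> complex ^ ('m \<times> 2).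
    smooth_on M s \<and> s ` M \<subseteq> sphere 0 1 \<and>
    (\<forall>z\<in>M. hline (s z) = \<phi> z) \<and>
    (\<forall>z\<in>M. twistor (cline (s z)) = \<phi> z) \<and>
    (\<forall>z\<in>M. \<forall>X. herm (frechet_derivative s (at z) X) (s z) = 0 \<and>
                herm (frechet_derivative s (at z) X) (jmul (s z)) = 0) \<and>
    isometric_immersion cline cp_hor M g (\<lambda>z. cline (s z)) \<and>
    minimal cline cp_hor M g (\<lambda>z. cline (s z)) \<and>
    cp_totally_real M (\<lambda>z. cline (s z))"
proof -
  have sm: "smooth_map hline hp_hor M \<phi>" using assms(5) by (simp add: isometric_immersion_def)
  obtain s where lift: "horizontal_lift M \<phi> s"
    by (rule horizontal_lift_exists[OF assms(1,3) sm assms(7)])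
  note s = horizontal_liftD[OF lift]
  note C = horizontal_lift_fibre_chart[OF assms(1) sm assms(7) lift]
  have cp_H: "v \<in> hp_hor q \<Longrightarrow> v \<in> cp_hor q" for v q :: "complex ^ ('m \<times> 2)"
    by (simp add: hp_hor_def cp_hor_def)
  let ?f = "\<lambda>z. cline (s z)"
  \<comment> \<open>At the centre both quotient metrics are the ambient inner product, and
    \<open>hp_hor q\<close> lies in \<open>cp_hor q\<close>; hence equal differentials have equal
    metric values in the two targets.\<close>
  have qm: "quot_metric cp_hor q (coord cline cp_hor q (?f p)) u v = u \<bullet> v"
    "quot_metric hp_hor q (coord hline hp_hor q (\<phi> p)) u v = u \<bullet> v"
    if "p \<in> M" "norm q = 1" "cline q = ?f p" "u \<in> hp_hor q" "v \<in> hp_hor q" for p q u v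
    using that C(1)[OF that(1-3)] cp.coord_base[OF that(2)] hp.coord_base[OF that(2)]
    by (simp_all add: cp.quot_metric_base cp_H hp.quot_metric_base)
  have "smooth_map cline cp_hor M ?f"
    unfolding smooth_map_def using C(2) s(2) by (auto simp: image_iff)
  moreover have "quot_metric cp_hor q (coord cline cp_hor q (?f p)) (diff_map cline cp_hor q ?f p X) (diff_map cline cp_hor q ?f p Y) = g p X Y"
    if "p \<in> M" "norm q = 1" "cline q = ?f p" for p q X Y
    using assms(5) that(1,2) C(1)[OF that]
    unfolding isometric_immersion_def C(3)[OF that] qm(1)[OF that C(4)[OF that] C(4)[OF that]]
      qm(2)[OF that C(4)[OF that] C(4)[OF that], symmetric] by simp
  ultimately have iso: "isometric_immersion cline cp_hor M g ?f"
    by (simp add: isometric_immersion_def)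
  \<comment> \<open>The second fundamental forms agree for every pair of directions, so their traces
    agree in every orthonormal frame.\<close>
  have min: "minimal cline cp_hor M g ?f"
    using assms(6) C(1,5) unfolding minimal_def by simp
  \<comment> \<open>On \<open>hp_hor q\<close> the complex structure of the twistor space and the
    endomorphism \<open>I\<close> for the representative \<open>q\<close> are the same
    multiplication by \<open>\<i>\<close>.\<close>
  have tr: "cp_totally_real M ?f"
    unfolding cp_totally_real_def form_pullback_zero_def
  proof (intro ballI impI allI)
    fix p q X Y assume p: "p \<in> M" and "q \<in> sphere 0 1" and "cline q = ?f p"
    then have q: "norm q = 1" "cline q = ?f p" by simp_all
    note Cq = C[OF p q]
    have "quot_metric hp_hor q (coord hline hp_hor q (\<phi> p)) (\<i> *s diff_map hline hp_hor q \<phi> p X) (diff_map hline hp_hor q \<phi> p Y) = 0"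
      using assms(7) p q(1) Cq(1) unfolding hp_totally_real_def form_pullback_zero_def by simp
    then show "quot_metric cp_hor q (coord cline cp_hor q (?f p)) (\<i> *s diff_map cline cp_hor q ?f p X) (diff_map cline cp_hor q ?f p Y) = 0"
      unfolding Cq(3) qm(1)[OF p q smult_mem_hp_hor[OF Cq(4)] Cq(4)] qm(2)[OF p q smult_mem_hp_hor[OF Cq(4)] Cq(4)] .
  qed
  show ?thesis
  proof (intro exI[of _ s] conjI)
    show "\<forall>z\<in>M. \<forall>X. herm (frechet_derivative s (at z) X) (s z) = 0 \<and>
                herm (frechet_derivative s (at z) X) (jmul (s z)) = 0"
      using s(4) by (simp add: hp_hor_def)
  qed (use s iso min tr in \<open>auto simp: twistor_cline\<close>)
qed

end
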